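(* Let $\varphi$ be an analytic self-map of $\mathbb{D}$ and let $n$ be a positive integer. The operator $D_{\varphi,n}$ is bounded on $H^{2}$ if and only if \[ N_{\varphi}(w)=O\Big(\big[\log(1/|w|)\big]^{2n+1}\Big)\qquad (|w|\to 1). \]
   Context: $\mathbb{D}$ is the open unit disk in $\mathbb{C}$ and $H^2$ is the Hardy space of analytic functions $f$ on $\mathbb{D}$ with $\|f\|^2=\lim_{r\to1}\frac{1}{2\pi}\int_0^{2\pi}|f(re^{i\theta})|^2\,d\theta<\infty$. For an analytic self-map $\varphi$ of $\mathbb{D}$ and a positive integer $n$, $D_{\varphi,n}$ is the operator $D_{\varphi,n}f=f^{(n)}\circ\varphi$ (composition operator $C_\varphi$ following $n$-th order differentiation). The Nevanlinna counting function is $N_{\varphi}(w)=\sum_{z\in\mathbb{D},\,\varphi(z)=w}\log(1/|z|)$ for $w\in\mathbb{D}\setminus\{\varphi(0)\}$ (multiplicities counted; $N_\varphi(w)=0$ if $w\notin\varphi(\mathbb{D})$), and $N_\varphi(\varphi(0))=\infty$. *)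

theory Defs
  imports "HOL-Complex_Analysis.Complex_Analysis"
begin

definition circle_mean2 :: "(complex \<Rightarrow> complex) \<Rightarrow> real \<Rightarrow> real" where
  "circle_mean2 f r = (1 / (2 * pi)) * integral {0..2*pi} (\<lambda>t. (cmod (f (complex_of_real r * cis t)))\<^sup>2)"

definition H2 :: "(complex \<Rightarrow> complex) set" where
  "H2 = {f. f holomorphic_on ball 0 1 \<and> bdd_above (circle_mean2 f ` {0<..<1})}"

text \<open>Squared H^2 norm: lim_{r->1} of the circle means (these means increase in r,
  so the limit equals the supremum).\<close>
definition H2_norm2 :: "(complex \<Rightarrow> complex) \<Rightarrow> real" where
  "H2_norm2 f = (SUP r\<in>{0<..<1}. circle_mean2 f r)"

definition D_op :: "(complex \<Rightarrow> complex) \<Rightarrow> nat \<Rightarrow> (complex \<Rightarrow> complex) \<Rightarrow> (complex \<Rightarrow> complex)" where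
  "D_op \<phi> n f = (deriv ^^ n) f \<circ> \<phi>"

definition D_bounded_H2 :: "(complex \<Rightarrow> complex) \<Rightarrow> nat \<Rightarrow> bool" where
  "D_bounded_H2 \<phi> n \<longleftrightarrow> (\<exists>C. \<forall>f\<in>H2. D_op \<phi> n f \<in> H2 \<and> H2_norm2 (D_op \<phi> n f) \<le> C * H2_norm2 f)"

definition nevanlinna :: "(complex \<Rightarrow> complex) \<Rightarrow> complex \<Rightarrow> ennreal" where
  "nevanlinna \<phi> w = (if w = \<phi> 0 then \<infinity> else
     (\<Sum>\<^sub>\<infinity> z\<in>{z\<in>ball 0 1. \<phi> z = w}.
        of_nat (nat (zorder (\<lambda>z. \<phi> z - w) z)) * ennreal (ln (1 / cmod z))))"

end

theory Submission
  imports Defs "HOL-Probability.Distributions" "HOL-Real_Asymp.Real_Asymp"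
begin

text \<open>
  Everything rests on Jensen's formula, and no change of variables is needed.

  Boundedness implies the growth condition: test on the Szego kernel $1/(1 - \bar a w)$ and apply Jensen's
  formula to a function with the same zeros as $\varphi - a$ whose logarithm is dominated by the squared
  modulus of the image of that kernel.

  Conversely, $|z|^2$ is, up to a constant, the logarithmic potential of the planar measure, so integrating
  Jensen's formula for $G - \alpha$ over $\alpha$ expresses the growth of the square means of $G$ by zero
  counts. For $G = g \circ \varphi$ with $g = f^{(n)}$ the growth condition bounds the zero counts of
  $G - \alpha$ by those of $g - \alpha$ on all smaller discs, weighted by $u^{2n-1}\,du$ at radius $e^{-u}$.
  The same identity, read backwards for $g$, gives square means of $g$, and Parseval's formula concludes.
\<close>

section \<open>Means over circles\<close>

text \<open>The exponent comes from (log 1/|w|)^(2n+1) = 2n(2n+1) times the integral over u > 0 of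
  u^(2n-1) (log(1/|w|) - u)^+. The last factor is what a zero of g - \<alpha> at w contributes to
  the zero count on radius e^(-u), so the power bound on the counting function turns into an
  expression linear in zero counts of g. In Parseval's series the weight u^(2n-1) divides the k-th
  term by a multiple of k^(2n), the factor that n differentiations put into the squared
  coefficients. In the other direction the squared norm of the kernel is 1/(1 - |a|^2), while its
  squared n-th derivative has size |1 - cnj a w|^(-2n-2); scaling by (1 - |a|^2)^(2n+2) leaves the
  power 2n+1. The growth condition says nothing on a disc |w| <= \<rho>. There Littlewood's
  inequality, itself a case of Jensen's formula, takes over, and the contribution is a square mean
  of g over a compact subset of the disc, controlled by pointwise bounds for Hardy
  functions.\<close>

definition circ :: "real measure" where
  "circ = uniform_measure lborel {0..2*pi}"

lemma sets_circ [simp, measurable_cong]: "sets circ = sets borel"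
  by (simp add: circ_def)

lemma space_circ [simp]: "space circ = UNIV"
  by (simp add: circ_def)

interpretation circ: prob_space circ
  unfolding circ_def by (rule prob_space_uniform_measure) auto

lemma measurable_circ_continuous: "continuous_on UNIV f \<Longrightarrow> f \<in> borel_measurable circ"
  by (subst measurable_cong_sets[OF sets_circ refl]) (rule borel_measurable_continuous_onI)

lemma circ_density: "circ = density lborel (\<lambda>t. ennreal (indicator {0..2*pi} t / (2*pi)))"
proof -
  have "indicator {0..2*pi} t / emeasure lborel {0..2*pi} = ennreal (indicator {0..2*pi} t / (2*pi))" for t :: real
    using divide_ennreal[of 1 "2*pi"] by (auto split: split_indicator)
  thus ?thesis unfolding circ_def uniform_measure_def by simp
qed

lemma AE_circ_countable: "countable A \<Longrightarrow> AE t in circ. t \<notin> A"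
  unfolding circ_def
  by (rule AE_uniform_measureI, simp)
     (use AE_not_in[OF countable_imp_null_set_lborel[of A]] in \<open>auto elim!: eventually_mono\<close>)

text \<open>Bridge from the gauge integrals in \<open>circle_mean2\<close> and in contour integrals
  to Bochner integrals over \<open>circ\<close>, where limit theorems and Fubini are at
  hand.\<close>

lemma has_bochner_integral_circ:
  fixes f :: "real \<Rightarrow> 'a::euclidean_space"
  assumes "continuous_on UNIV f"
  shows "has_bochner_integral circ f ((1 / (2*pi)) *\<^sub>R integral {0..2*pi} f)"
proof -
  have [measurable]: "f \<in> borel_measurable borel"
    using assms by (rule borel_measurable_continuous_onI)
  have si: "set_integrable lborel {0..2*pi} f"
    by (rule borel_integrable_atLeastAtMost') (use assms continuous_on_subset in blast)
  have "has_bochner_integral lborel (\<lambda>t. indicator {0..2*pi} t *\<^sub>R f t) (integral {0..2*pi} f)"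
    using si set_borel_integral_eq_integral(2)[OF si]
    by (simp add: has_bochner_integral_iff set_integrable_def set_lebesgue_integral_def)
  hence "has_bochner_integral lborel (\<lambda>t. (1 / (2*pi)) *\<^sub>R (indicator {0..2*pi} t *\<^sub>R f t)) ((1 / (2*pi)) *\<^sub>R integral {0..2*pi} f)"
    by (intro has_bochner_integral_scaleR_right) auto
  thus ?thesis unfolding circ_density
    by (intro has_bochner_integral_density) (auto simp: field_simps)
qed

lemma circle_mean2_circ:
  assumes "continuous_on (sphere 0 r) f" "r \<ge> 0"
  shows "has_bochner_integral circ (\<lambda>t. (cmod (f (complex_of_real r * cis t)))\<^sup>2) (circle_mean2 f r)"
proof -
  have "continuous_on UNIV (\<lambda>t. (cmod (f (complex_of_real r * cis t)))\<^sup>2)"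
    by (intro continuous_intros continuous_on_compose2[OF assms(1)]) (use assms in \<open>auto simp: norm_mult\<close>)
  from has_bochner_integral_circ[OF this] show ?thesis
    by (simp add: circle_mean2_def)
qed

text \<open>On the circle dz = \<i> z dt, so dividing a contour integral by 2 pi \<i> leaves the
  mean of g(z) z.\<close>

lemma has_bochner_integral_circ_contour:
  assumes "continuous_on (sphere 0 r) g" "0 < r" "(g has_contour_integral I) (circlepath 0 r)"
  shows "has_bochner_integral circ (\<lambda>t. g (complex_of_real r * cis t) * (complex_of_real r * cis t)) (I / (2 * pi * \<i>))"
proof -
  have "((\<lambda>t. g (r * cis t) * r * \<i> * cis t) has_integral I) {0..2*pi}"
    using assms(3) unfolding circlepath_def by (subst (asm) has_contour_integral_part_circlepath_iff) auto
  hence "((\<lambda>t. (1/\<i>) * (g (r * cis t) * r * \<i> * cis t)) has_integral (1/\<i>) * I) {0..2*pi}"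
    by (rule has_integral_mult_right)
  hence *: "((\<lambda>t. g (r * cis t) * (r * cis t)) has_integral (1/\<i>) * I) {0..2*pi}"
    by (simp add: mult_ac)
  have "continuous_on UNIV (\<lambda>t. g (complex_of_real r * cis t) * (complex_of_real r * cis t))"
    by (intro continuous_intros continuous_on_compose2[OF assms(1)]) (use assms in \<open>auto simp: norm_mult\<close>)
  from has_bochner_integral_circ[OF this]
  have "has_bochner_integral circ (\<lambda>t. g (complex_of_real r * cis t) * (complex_of_real r * cis t))
      ((1 / (2*pi)) *\<^sub>R ((1/\<i>) * I))"
    unfolding integral_unique[OF *] .
  moreover have "(1 / (2*pi)) *\<^sub>R ((1/\<i>) * I) = I / (2 * pi * \<i>)"
    by (simp add: scaleR_conv_of_real field_simps)
  ultimately show ?thesis by simp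
qed

lemma has_bochner_integral_circ_Cauchy:
  assumes "f holomorphic_on ball 0 R" "0 < r" "r < R" "cmod w < r"
  shows "has_bochner_integral circ
    (\<lambda>t. f (complex_of_real r * cis t) * (r * cis t) / (r * cis t - w)) (f w)"
proof -
  have sub: "cball 0 r \<subseteq> ball (0::complex) R" using assms by auto
  have ci: "((\<lambda>u. f u / (u - w)) has_contour_integral (2 * of_real pi * \<i> * f w)) (circlepath 0 r)"
    by (rule Cauchy_integral_circlepath_simple) (use assms sub holomorphic_on_subset in auto)
  have "continuous_on (sphere 0 r) (\<lambda>u. f u / (u - w))"
    using assms by (intro continuous_intros holomorphic_on_imp_continuous_on holomorphic_on_subset[OF assms(1)]) auto
  from has_bochner_integral_circ_contour[OF this assms(2) ci] show ?thesis by simp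
qed

lemma has_bochner_integral_circ_mean_value:
  assumes "f holomorphic_on ball 0 R" "0 < r" "r < R"
  shows "has_bochner_integral circ (\<lambda>t. f (complex_of_real r * cis t)) (f 0)"
  using has_bochner_integral_circ_Cauchy[OF assms, of 0] assms by simp

text \<open>A zero-free function on a disc has a holomorphic logarithm; the mean value property is
  applied to its real part.\<close>

lemma mean_ln_nonvanishing:
  assumes "f holomorphic_on ball 0 R" "0 < r" "r < R" "\<And>z. z \<in> ball 0 R \<Longrightarrow> f z \<noteq> 0"
  shows "has_bochner_integral circ (\<lambda>t. ln (cmod (f (complex_of_real r * cis t)))) (ln (cmod (f 0)))"
proof -
  obtain g where g: "g holomorphic_on ball 0 R" "\<And>x. x \<in> ball 0 R \<Longrightarrow> exp (g x) = f x"
    using holomorphic_logarithm_exists[of "ball 0 R" f 0] assms by auto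
  have ln: "ln (cmod (f z)) = Re (g z)" if "z \<in> ball 0 R" for z
    using g(2)[OF that, symmetric] by simp
  have "has_bochner_integral circ (\<lambda>t. Re (g (complex_of_real r * cis t))) (Re (g 0))"
    by (intro has_bochner_integral_Re has_bochner_integral_circ_mean_value[OF g(1) assms(2,3)])
  moreover have "Re (g (complex_of_real r * cis t)) = ln (cmod (f (complex_of_real r * cis t)))" for t
    by (rule ln[symmetric]) (use assms in \<open>auto simp: norm_mult\<close>)
  ultimately show ?thesis using ln[of 0] assms by simp
qed

text \<open>Zeros on a circle of integration occur only at countably many angles, a null set.
  Logarithms take the default value \<open>ln 0 = 0\<close> there.\<close>

lemma countable_cis_eq: "countable {t. cis t = c}"
proof (cases "\<exists>t0. cis t0 = c")
  case True
  then obtain t0 where t0: "cis t0 = c" by blast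
  have "{t. cis t = c} \<subseteq> (\<lambda>k::int. t0 + 2*pi*k) ` UNIV"
  proof
    fix t assume "t \<in> {t. cis t = c}"
    hence "cis t = cis t0" using t0 by simp
    hence "cos t = cos t0" "sin t = sin t0" by (auto simp: complex_eq_iff)
    hence "\<exists>n::int. t = t0 + 2*pi*n" using sin_cos_eq_iff[of t t0] by blast
    thus "t \<in> (\<lambda>k::int. t0 + 2*pi*k) ` UNIV" by auto
  qed
  thus ?thesis by (rule countable_subset) simp
qed auto

text \<open>For a outside the circle the linear factor is zero-free on a larger disc. For a inside,
  it is replaced by its reflection in the circle, which has the same modulus there and no zero
  inside. For a on the circle, where the logarithm is singular, the zero is approached from
  outside.\<close>

lemma mean_ln_dist:
  assumes "r > 0"
  shows "has_bochner_integral circ (\<lambda>t. ln (cmod (complex_of_real r * cis t - a))) (ln (max r (cmod a)))"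
proof -
  have outer: "has_bochner_integral circ (\<lambda>t. ln (cmod (complex_of_real r * cis t - a))) (ln (cmod a))"
    if "cmod a > r" for a
    using mean_ln_nonvanishing[of "\<lambda>z. z - a" "cmod a" r] assms that
    by (force intro!: holomorphic_intros)
  consider "cmod a > r" | "cmod a < r" | "cmod a = r" by linarith
  thus ?thesis
  proof cases
    case 1
    thus ?thesis using outer[of a] by (simp add: max_def)
  next
    case 2
    \<comment> \<open>The reflected factor r - cnj a z / r vanishes at r^2 / cnj a, and R is the
      modulus of that point. For a = 0 the factor is constant and any R > r will do.\<close>
    define R where "R = (if a = 0 then r + 1 else r\<^sup>2 / cmod a)"
    have R: "r < R" using 2 assms by (auto simp: R_def field_simps power2_eq_square)
    have nz: "r - cnj a * z / r \<noteq> 0" if "z \<in> ball 0 R" for z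
    proof
      assume "r - cnj a * z / r = 0"
      hence "complex_of_real r * r = cnj a * z" using assms by (simp add: field_simps)
      hence "cmod (complex_of_real r * r) = cmod (cnj a * z)" by simp
      hence e: "r\<^sup>2 = cmod a * cmod z" using assms by (simp add: norm_mult power2_eq_square)
      hence "a \<noteq> 0" using assms by auto
      hence "cmod z < r\<^sup>2 / cmod a" using that by (simp add: R_def)
      with e \<open>a \<noteq> 0\<close> show False by (simp add: field_simps)
    qed
    have "has_bochner_integral circ (\<lambda>t. ln (cmod (r - cnj a * (complex_of_real r * cis t) / r))) (ln (cmod (r - cnj a * 0 / r)))"
      by (rule mean_ln_nonvanishing[where R=R]) (use assms R nz in \<open>auto intro!: holomorphic_intros\<close>)
    moreover have "cmod (r - cnj a * (complex_of_real r * cis t) / r) = cmod (complex_of_real r * cis t - a)" for t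
    proof -
      have "r - cnj a * (complex_of_real r * cis t) / r = cis t * cnj (complex_of_real r * cis t - a)"
        using assms by (simp add: cis_cnj algebra_simps cis_mult)
      thus ?thesis by (simp add: norm_mult del: complex_cnj_diff complex_cnj_mult)
    qed
    ultimately show ?thesis using 2 assms by simp
  next
    case 3
    \<comment> \<open>The zero is moved radially to the point \<open>s n * a\<close> outside the
      circle, with \<open>s n\<close> decreasing to 1.\<close>
    define s where "s = (\<lambda>n. 1 + 1 / (real n + 1))"
    have s1: "s n > 1" for n by (simp add: s_def)
    have sdec: "s n \<le> s m" if "m \<le> n" for m n using that by (simp add: s_def field_simps)
    have slim: "s \<longlonglongrightarrow> 1" unfolding s_def
      using tendsto_add[OF tendsto_const[of 1] LIMSEQ_inverse_real_of_nat] by (simp add: inverse_eq_divide add.commute)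
    \<comment> \<open>As |b| = |a| = r, the function x -> |b - x a|^2 is increasing for x >= 1.
      Hence the negated logarithms increase with n and monotone convergence copes with the
      singularity at the angle of a.\<close>
    have mono: "cmod (r * cis t - x * a) \<le> cmod (r * cis t - y * a)" if "1 \<le> x" "x \<le> y" for t x y :: real
    proof -
      define b where "b = r * cis t"
      have nb: "cmod b = r" using assms by (simp add: b_def norm_mult)
      have e: "(cmod (b - x * a))\<^sup>2 = r\<^sup>2 + x\<^sup>2 * r\<^sup>2 - 2 * x * Re (b * cnj a)" for x :: real
      proof -
        have "(cmod (b - x * a))\<^sup>2 = (cmod b)\<^sup>2 + x\<^sup>2 * (cmod a)\<^sup>2 - 2 * x * Re (b * cnj a)"
          by (simp only: cmod_power2) (simp add: power2_eq_square algebra_simps)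
        thus ?thesis using nb 3 by simp
      qed
      have "Re (b * cnj a) \<le> r\<^sup>2"
        using complex_Re_le_cmod[of "b * cnj a"] nb 3 by (simp add: norm_mult power2_eq_square)
      moreover have "(y - x) * (2 * r\<^sup>2) \<le> (y - x) * ((x + y) * r\<^sup>2)"
        using that by (intro mult_left_mono mult_right_mono) auto
      moreover have "(y - x) * (2 * Re (b * cnj a)) \<le> (y - x) * (2 * r\<^sup>2)"
        using that calculation(1) by (intro mult_left_mono) auto
      ultimately have "(y - x) * (2 * Re (b * cnj a)) \<le> (y - x) * ((x + y) * r\<^sup>2)" by linarith
      hence "(cmod (b - x * a))\<^sup>2 \<le> (cmod (b - y * a))\<^sup>2"
        unfolding e by (simp add: algebra_simps power2_eq_square)
      thus ?thesis by (simp add: b_def)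
    qed
    have int: "has_bochner_integral circ (\<lambda>t. - ln (cmod (r * cis t - s n * a))) (- ln (s n * r))" for n
    proof -
      have "cmod (s n * a) = s n * r" using s1[of n] 3 by (simp add: norm_mult)
      moreover have "cmod (s n * a) > r" using s1[of n] 3 assms by (simp add: norm_mult)
      ultimately show ?thesis using outer[of "s n * a"] has_bochner_integral_minus by fastforce
    qed
    have nz: "cmod (r * cis t - s n * a) > 0" for n t
    proof -
      have "cmod (s n * a) > r" using s1[of n] 3 assms by (simp add: norm_mult)
      hence "r * cis t \<noteq> s n * a" using assms by (metis abs_of_pos less_irrefl norm_cis norm_mult norm_of_real mult.right_neutral)
      thus ?thesis by simp
    qed
    have "has_bochner_integral circ (\<lambda>t. - ln (cmod (r * cis t - a))) (- ln r)"
    proof (rule has_bochner_integral_monotone_convergence)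
      show "integrable circ (\<lambda>t. - ln (cmod (r * cis t - s n * a)))" for n
        using int by (simp add: has_bochner_integral_iff)
      show "AE t in circ. mono (\<lambda>n. - ln (cmod (r * cis t - s n * a)))"
      proof (intro AE_I2 monoI)
        fix t and m n :: nat assume "m \<le> n"
        hence "cmod (r * cis t - s n * a) \<le> cmod (r * cis t - s m * a)"
          using s1[of n] sdec by (intro mono) auto
        with nz show "- ln (cmod (r * cis t - s m * a)) \<le> - ln (cmod (r * cis t - s n * a))" by simp
      qed
      have "AE t in circ. t \<notin> {t. cis t = a / r}"
        by (intro AE_circ_countable countable_cis_eq)
      thus "AE t in circ. (\<lambda>n. - ln (cmod (r * cis t - s n * a))) \<longlonglongrightarrow> - ln (cmod (r * cis t - a))"
      proof eventually_elim
        case (elim t)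
        hence "cmod (r * cis t - a) \<noteq> 0" using assms by (auto simp: field_simps)
        moreover have "(\<lambda>n. r * cis t - s n * a) \<longlonglongrightarrow> r * cis t - complex_of_real 1 * a"
          by (intro tendsto_intros slim)
        hence "(\<lambda>n. cmod (r * cis t - s n * a)) \<longlonglongrightarrow> cmod (r * cis t - a)"
          using tendsto_norm by fastforce
        ultimately show ?case by (intro tendsto_minus tendsto_ln)
      qed
      have "(\<lambda>n. - ln (s n * r)) \<longlonglongrightarrow> - ln (1 * r)"
        by (intro tendsto_intros slim) (use assms in auto)
      thus "(\<lambda>n. \<integral>t. - ln (cmod (r * cis t - s n * a)) \<partial>circ) \<longlonglongrightarrow> - ln r"
        unfolding has_bochner_integral_integral_eq[OF int] by simp
      show "(\<lambda>t. - ln (cmod (r * cis t - a))) \<in> borel_measurable circ"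
        by (rule borel_measurable_uminus, rule borel_measurable_ln, rule measurable_circ_continuous)
           (intro continuous_intros)
    qed
    from has_bochner_integral_minus[OF this] show ?thesis using 3 by simp
  qed
qed

section \<open>Jensen's formula\<close>

text \<open>Jensen's term, Nevanlinna's integrated counting function of the zeros. Zeros on the
  boundary circle contribute ln 1 = 0. A zero at the origin would contribute 0 as well, by the
  defaults \<open>r / 0 = 0\<close> and \<open>ln 0 = 0\<close>, so the quantity is meaningful for f
  0 \<noteq> 0.\<close>

definition zero_count :: "(complex \<Rightarrow> complex) \<Rightarrow> real \<Rightarrow> real" where
  "zero_count f r = (\<Sum>z\<in>{z\<in>cball 0 r. f z = 0}. zorder f z * ln (r / cmod z))"

section \<open>Orders of zeros and factorisation\<close>

lemma eventually_nonzero_at: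
  assumes "f holomorphic_on S" "open S" "connected S" "z \<in> S" "w \<in> S" "f w \<noteq> 0"
  shows "eventually (\<lambda>x. f x \<noteq> 0) (at z)"
  using non_zero_neighbour_alt[OF assms(1-4) assms(5,6)] by (rule eventually_mono) simp

lemma zorder_times_nonvanishing:
  assumes "f holomorphic_on S" "u holomorphic_on S" "open S" "connected S" "z \<in> S" "u z \<noteq> 0"
    and "w \<in> S" "f w \<noteq> 0"
  shows "zorder (\<lambda>x. f x * u x) z = zorder f z"
proof -
  have "eventually (\<lambda>x. f x \<noteq> 0) (at z)" "eventually (\<lambda>x. u x \<noteq> 0) (at z)"
    using eventually_nonzero_at[OF assms(1) assms(3-5) assms(7,8)]
      eventually_nonzero_at[OF assms(2) assms(3-5) assms(5,6)] by auto
  hence "eventually (\<lambda>x. f x * u x \<noteq> 0) (at z)" by eventually_elim auto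
  moreover have "f analytic_on {z}" "u analytic_on {z}"
    using assms analytic_at by blast+
  ultimately show ?thesis
    using zorder_times_analytic[of f z u] zorder_eq_0I[of u z] assms by simp
qed

lemma zorder_nonneg:
  assumes "f holomorphic_on S" "open S" "connected S" "z \<in> S" "w \<in> S" "f w \<noteq> 0"
  shows "zorder f z \<ge> 0" "f z = 0 \<Longrightarrow> zorder f z > 0"
proof -
  have "\<exists>w\<in>S. f w \<noteq> 0" using assms by blast
  from zorder_exist_zero[OF assms(1-4) this]
  show "zorder f z \<ge> 0" "f z = 0 \<Longrightarrow> zorder f z > 0" by (auto split: if_splits)
qed

text \<open>The local factor \<open>zor_poly\<close> near a and the quotient of f by the power of z
  - a elsewhere agree on the overlap, which glues them to one holomorphic function on S.\<close>

lemma holomorphic_divide_out_zero: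
  assumes f: "f holomorphic_on S" "open S" "connected S" "a \<in> S" "w \<in> S" "f w \<noteq> 0"
  obtains h where "h holomorphic_on S" "h a \<noteq> 0"
    "\<And>z. z \<in> S \<Longrightarrow> f z = h z * (z - a) ^ nat (zorder f a)"
proof -
  define k where "k = nat (zorder f a)"
  obtain e where e: "e > 0" "cball a e \<subseteq> S" "zor_poly f a holomorphic_on cball a e"
    "\<And>z. z \<in> cball a e \<Longrightarrow> f z = zor_poly f a z * (z - a) ^ k \<and> zor_poly f a z \<noteq> 0"
    using zorder_exist_zero[OF f(1-4)] f(5,6) unfolding k_def by blast
  define h where "h = (\<lambda>z. if z = a then zor_poly f a a else f z / (z - a) ^ k)"
  have h1: "h z = zor_poly f a z" if "z \<in> ball a e" for z
    using e(4)[of z] that by (auto simp: h_def)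
  have "h holomorphic_on ball a e"
    using holomorphic_transform[of "zor_poly f a" "ball a e" h] h1 e(3) holomorphic_on_subset[OF e(3) ball_subset_cball]
    by force
  moreover have "h holomorphic_on S - {a}"
  proof (rule holomorphic_transform)
    show "(\<lambda>z. f z / (z - a) ^ k) holomorphic_on S - {a}"
      by (intro holomorphic_intros holomorphic_on_subset[OF f(1)]) auto
  qed (auto simp: h_def)
  ultimately have "h holomorphic_on ball a e \<union> (S - {a})"
    by (intro holomorphic_on_Un) (use f in auto)
  hence "h holomorphic_on S"
    by (rule holomorphic_on_subset) (use e(1) in auto)
  moreover have "h a \<noteq> 0" using e(1) e(4)[of a] by (auto simp: h_def)
  moreover have "f z = h z * (z - a) ^ k" if "z \<in> S" for z
    using e(4)[of a] e(1) by (auto simp: h_def)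
  ultimately show ?thesis using that k_def by blast
qed

text \<open>Induction on the number of distinct zeros: one zero is divided out with its full
  multiplicity, and its linear factor is handled by \<open>mean_ln_dist\<close>. The sum runs over
  the larger disc, and the maximum makes zeros beyond radius r contribute 0, so the step is the same
  whichever zero is taken.\<close>

lemma Jensen_aux:
  assumes "f holomorphic_on ball 0 R" "f 0 \<noteq> 0" "0 < r" "r < R" "finite {z\<in>ball 0 R. f z = 0}"
  shows "has_bochner_integral circ (\<lambda>t. ln (cmod (f (complex_of_real r * cis t))))
    (ln (cmod (f 0)) + (\<Sum>z\<in>{z\<in>ball 0 R. f z = 0}. zorder f z * (ln (max r (cmod z)) - ln (cmod z))))"
  using assms
proof (induction "card {z\<in>ball 0 R. f z = 0}" arbitrary: f)
  case 0
  hence "{z\<in>ball 0 R. f z = 0} = {}" by (metis card_0_eq)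
  moreover from this have "has_bochner_integral circ (\<lambda>t. ln (cmod (f (complex_of_real r * cis t)))) (ln (cmod (f 0)))"
    by (intro mean_ln_nonvanishing[OF 0(2,4,5)]) blast
  ultimately show ?case by (simp only: sum.empty add_0_right)
next
  case (Suc n f)
  let ?Z = "\<lambda>f. {z\<in>ball (0::complex) R. f z = (0::complex)}"
  from Suc.hyps(2) obtain a where a: "a \<in> ?Z f" by (metis card.empty ex_in_conv nat.distinct(1))
  have R: "0 \<in> ball (0::complex) R" using Suc.prems by simp
  obtain h where h: "h holomorphic_on ball 0 R" "h a \<noteq> 0"
    "\<And>z. z \<in> ball 0 R \<Longrightarrow> f z = h z * (z - a) ^ nat (zorder f a)"
    using holomorphic_divide_out_zero[OF Suc.prems(1) open_ball connected_ball _ R Suc.prems(2), of a] a by blast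
  define k where "k = nat (zorder f a)"
  have "zorder f a > 0"
    by (rule zorder_nonneg(2)[OF Suc.prems(1) open_ball connected_ball _ R Suc.prems(2)]) (use a in auto)
  hence k: "k > 0" "zorder f a = int k" by (auto simp: k_def)
  have a0: "a \<noteq> 0" using a Suc.prems(2) by auto
  note h3 = h(3)[folded k_def]
  have h0: "h 0 \<noteq> 0" using h3[OF R] Suc.prems(2) by auto
  have Z: "?Z f = insert a (?Z h)" "a \<notin> ?Z h"
    using a h(2) h3 k by auto
  have fin: "finite (?Z h)" using Suc.prems(5) Z by simp
  have ord: "zorder f z = zorder h z" if "z \<in> ?Z h" for z
  proof -
    have "zorder f z = zorder (\<lambda>z. h z * (z - a) ^ k) z"
    proof (rule zorder_cong)
      show "eventually (\<lambda>z. f z = h z * (z - a) ^ k) (at z)"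
        using that eventually_at_in_open'[of "ball 0 R" z] h3 by (auto elim!: eventually_mono)
    qed auto
    also have "\<dots> = zorder h z"
      by (rule zorder_times_nonvanishing[of _ "ball 0 R" _ _ 0])
         (use that R h(1,2) h0 in \<open>auto intro!: holomorphic_intros\<close>)
    finally show ?thesis .
  qed
  let ?T = "\<lambda>f z. zorder f z * (ln (max r (cmod z)) - ln (cmod z))"
  have IH: "has_bochner_integral circ (\<lambda>t. ln (cmod (h (complex_of_real r * cis t))))
    (ln (cmod (h 0)) + (\<Sum>z\<in>?Z h. ?T h z))"
    by (rule Suc.hyps(1)) (use Suc.hyps(2) Z fin h h0 Suc.prems in auto)
  have "has_bochner_integral circ (\<lambda>t. ln (cmod (h (complex_of_real r * cis t))) + k * ln (cmod (complex_of_real r * cis t - a)))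
    (ln (cmod (h 0)) + (\<Sum>z\<in>?Z h. ?T h z) + k * ln (max r (cmod a)))"
    by (intro has_bochner_integral_add IH has_bochner_integral_mult_right mean_ln_dist Suc.prems)
  also have "?this \<longleftrightarrow> has_bochner_integral circ (\<lambda>t. ln (cmod (f (complex_of_real r * cis t))))
    (ln (cmod (h 0)) + (\<Sum>z\<in>?Z h. ?T h z) + k * ln (max r (cmod a)))"
  proof (rule has_bochner_integral_cong_AE)
    \<comment> \<open>The logarithm of the product splits where f does not vanish, that is, off
      countably many angles.\<close>
    have "AE t in circ. t \<notin> (\<Union>z\<in>?Z f. {t. cis t = z / r})"
      by (intro AE_circ_countable countable_UN countable_cis_eq countable_finite Suc.prems)
    thus "AE t in circ. ln (cmod (h (complex_of_real r * cis t))) + k * ln (cmod (complex_of_real r * cis t - a)) =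
        ln (cmod (f (complex_of_real r * cis t)))"
    proof eventually_elim
      case (elim t)
      define z where "z = complex_of_real r * cis t"
      have zb: "z \<in> ball 0 R" using Suc.prems by (simp add: z_def norm_mult)
      have "f z \<noteq> 0"
      proof
        assume "f z = 0"
        hence "z \<in> ?Z f" "cis t = z / r" using zb Suc.prems by (auto simp: z_def)
        with elim show False by blast
      qed
      with h3[OF zb] k have nz: "h z \<noteq> 0" "z \<noteq> a" by auto
      have "ln (cmod (f z)) = ln (cmod (h z)) + k * ln (cmod (z - a))"
        unfolding h3[OF zb] using nz by (simp add: norm_mult norm_power ln_mult ln_realpow)
      thus ?case by (simp add: z_def)
    qed
  next
    show "(\<lambda>t. ln (cmod (f (complex_of_real r * cis t)))) \<in> borel_measurable circ"
      by (intro borel_measurable_ln measurable_circ_continuous continuous_intros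
            continuous_on_compose2[OF holomorphic_on_imp_continuous_on[OF Suc.prems(1)]])
         (use Suc.prems in \<open>auto simp: norm_mult\<close>)
    show "(\<lambda>t. ln (cmod (h (complex_of_real r * cis t))) + k * ln (cmod (complex_of_real r * cis t - a))) \<in> borel_measurable circ"
      by (intro borel_measurable_add borel_measurable_times borel_measurable_ln measurable_circ_continuous continuous_intros
            continuous_on_compose2[OF holomorphic_on_imp_continuous_on[OF h(1)]])
         (use Suc.prems in \<open>auto simp: norm_mult\<close>)
  qed
  also have "ln (cmod (h 0)) + (\<Sum>z\<in>?Z h. ?T h z) + k * ln (max r (cmod a)) = ln (cmod (f 0)) + (\<Sum>z\<in>?Z f. ?T f z)"
  proof -
    have "ln (cmod (f 0)) = ln (cmod (h 0)) + k * ln (cmod a)"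
      unfolding h3[OF R] using h0 a0 by (simp add: norm_mult norm_power ln_mult ln_realpow)
    moreover have "(\<Sum>z\<in>?Z f. ?T f z) = ?T f a + (\<Sum>z\<in>?Z h. ?T h z)"
      unfolding Z(1) sum.insert[OF fin Z(2)] by (intro arg_cong2[where f="(+)"] refl sum.cong) (simp add: ord)
    ultimately show ?thesis using k by (simp add: algebra_simps)
  qed
  finally show ?case .
qed

theorem Jensen:
  assumes "f holomorphic_on ball 0 R" "f 0 \<noteq> 0" "0 < r" "r < R"
  shows "has_bochner_integral circ (\<lambda>t. ln (cmod (f (complex_of_real r * cis t)))) (ln (cmod (f 0)) + zero_count f r)"
    and "finite {z\<in>cball 0 r. f z = 0}"
proof -
  \<comment> \<open>The disc of radius R may contain infinitely many zeros; a compact smaller disc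
    contains finitely many, since f 0 \<noteq> 0 rules out the zero function.\<close>
  obtain q where q: "r < q" "q < R" using assms dense by blast
  have fin: "finite {z\<in>cball 0 q. f z = 0}" if "q < R" "q > 0" for q
  proof (cases "f constant_on ball 0 R")
    case True
    hence "{z\<in>cball 0 q. f z = 0} = {}" using assms that by (force simp: constant_on_def)
    thus ?thesis by (metis finite.emptyI)
  next
    case False
    show ?thesis
      by (rule holomorphic_compact_finite_zeros[OF assms(1)]) (use False that in auto)
  qed
  thus fr: "finite {z\<in>cball 0 r. f z = 0}" using assms by auto
  have hq: "f holomorphic_on ball 0 q" using assms(1) by (rule holomorphic_on_subset) (use q in auto)
  have fq: "finite {z\<in>ball 0 q. f z = 0}"
    by (rule finite_subset[OF _ fin[of q]]) (use q assms in auto)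
  have "(\<Sum>z\<in>{z\<in>ball 0 q. f z = 0}. zorder f z * (ln (max r (cmod z)) - ln (cmod z))) = zero_count f r"
    unfolding zero_count_def
  proof (rule sum.mono_neutral_cong_right[OF fq])
    fix z assume "z \<in> {z\<in>cball 0 r. f z = 0}"
    hence "z \<noteq> 0" "cmod z \<le> r" using assms by auto
    thus "zorder f z * (ln (max r (cmod z)) - ln (cmod z)) = zorder f z * ln (r / cmod z)"
      using assms by (simp add: ln_div max_def)
  qed (use q in auto)
  with Jensen_aux[OF hq assms(2,3) q(1) fq]
  show "has_bochner_integral circ (\<lambda>t. ln (cmod (f (complex_of_real r * cis t)))) (ln (cmod (f 0)) + zero_count f r)"
    by simp
qed

section \<open>Square means and the planar measure\<close>

text \<open>Planar measure in polar coordinates, taken directly as a product so that Jensen's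
  formula can be integrated circle by circle. The factor 4 fixes the normalisation: 4 \<rho> d\<rho>
  dt / (2 pi) is 2/pi times area, and the potential of log |w - a| against it has Laplacian 4, the
  Laplacian of |a|^2. Negative radii get density 0, as \<open>ennreal\<close> sends negative numbers
  to 0.\<close>

definition polar :: "(real \<times> real) measure" where
  "polar = density lborel (\<lambda>\<rho>. ennreal (4 * \<rho>)) \<Otimes>\<^sub>M circ"

definition polar_pt :: "real \<times> real \<Rightarrow> complex" where
  "polar_pt q = complex_of_real (fst q) * cis (snd q)"

lemma sets_polar [simp, measurable_cong]: "sets polar = sets (borel \<Otimes>\<^sub>M borel)"
  unfolding polar_def by (intro sets_pair_measure_cong) auto

lemma space_polar [simp]: "space polar = UNIV"
  by (simp add: polar_def space_pair_measure)

lemma measurable_cis [measurable]: "cis \<in> borel_measurable borel"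
  by (intro borel_measurable_continuous_onI continuous_intros)

lemma measurable_polar_pt [measurable]: "polar_pt \<in> borel_measurable (borel \<Otimes>\<^sub>M borel)"
  unfolding polar_pt_def by measurable

interpretation radial: sigma_finite_measure "density lborel (\<lambda>\<rho>::real. ennreal (4 * \<rho>))"
  by (subst sigma_finite_measure.sigma_finite_iff_density_finite[OF sigma_finite_lborel]) auto

interpretation polar: sigma_finite_measure polar
  unfolding polar_def
  by (intro sigma_finite_pair_measure radial.sigma_finite_measure_axioms circ.sigma_finite_measure_axioms)

interpretation polar_circ: pair_sigma_finite polar circ ..

lemma measurable_polar_pt_eq [measurable]: "{q. polar_pt q = a} \<in> sets (borel \<Otimes>\<^sub>M borel)"
proof -
  have "polar_pt -` {a} \<inter> space (borel \<Otimes>\<^sub>M borel) \<in> sets (borel \<Otimes>\<^sub>M borel)"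
    by (rule measurable_sets[OF measurable_polar_pt]) simp
  moreover have "polar_pt -` {a} \<inter> space (borel \<Otimes>\<^sub>M borel) = {q. polar_pt q = a}"
    by (auto simp: space_pair_measure)
  ultimately show ?thesis by simp
qed

lemma measurable_fst_neg [measurable]: "{q::real \<times> real. fst q < 0} \<in> sets (borel \<Otimes>\<^sub>M borel)"
proof -
  have "fst -` {..<0::real} \<inter> space (borel \<Otimes>\<^sub>M (borel::real measure)) \<in> sets (borel \<Otimes>\<^sub>M borel)"
    by (rule measurable_sets[OF measurable_fst]) simp
  moreover have "fst -` {..<0::real} \<inter> space (borel \<Otimes>\<^sub>M (borel::real measure)) = {q. fst q < 0}"
    by (auto simp: space_pair_measure)
  ultimately show ?thesis by simp
qed

lemma has_bochner_integral_circ_const: "has_bochner_integral circ (\<lambda>_. c::real) c"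
  using circ.prob_space by (simp add: has_bochner_integral_iff)

lemma measurable_polar_pt_polar [measurable]: "polar_pt \<in> borel_measurable polar"
  by (subst measurable_cong_sets[OF sets_polar refl]) (rule measurable_polar_pt)

lemma nn_integral_polar:
  assumes [measurable]: "f \<in> borel_measurable (borel \<Otimes>\<^sub>M borel)"
  shows "(\<integral>\<^sup>+q. f q \<partial>polar) = (\<integral>\<^sup>+\<rho>. ennreal (4 * \<rho>) * (\<integral>\<^sup>+\<theta>. f (\<rho>, \<theta>) \<partial>circ) \<partial>lborel)"
proof -
  have "(\<integral>\<^sup>+q. f q \<partial>polar) = (\<integral>\<^sup>+\<rho>. (\<integral>\<^sup>+\<theta>. f (\<rho>, \<theta>) \<partial>circ) \<partial>density lborel (\<lambda>\<rho>. ennreal (4 * \<rho>)))"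
    unfolding polar_def by (rule circ.nn_integral_fst[symmetric]) measurable
  also have "\<dots> = (\<integral>\<^sup>+\<rho>. ennreal (4 * \<rho>) * (\<integral>\<^sup>+\<theta>. f (\<rho>, \<theta>) \<partial>circ) \<partial>lborel)"
    by (rule nn_integral_density) measurable
  finally show ?thesis .
qed

text \<open>Jensen's formula for f - \<alpha> requires \<alpha> \<noteq> f 0; by this lemma dropping
  one value does not affect integrals over \<alpha>.\<close>

lemma AE_polar_neq: "AE q in polar. polar_pt q \<noteq> a"
proof -
  have "(\<integral>\<^sup>+q. indicator {q. polar_pt q = a} q \<partial>polar)
      = (\<integral>\<^sup>+\<rho>. ennreal (4 * \<rho>) * (\<integral>\<^sup>+\<theta>. indicator {q. polar_pt q = a} (\<rho>, \<theta>) \<partial>circ) \<partial>lborel)"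
    by (rule nn_integral_polar) measurable
  also have "\<dots> = (\<integral>\<^sup>+\<rho>. 0 \<partial>(lborel :: real measure))"
  proof (intro nn_integral_cong)
    fix \<rho> :: real
    show "ennreal (4 * \<rho>) * (\<integral>\<^sup>+\<theta>. indicator {q. polar_pt q = a} (\<rho>, \<theta>) \<partial>circ) = 0"
    proof (cases "\<rho> > 0")
      case True
      have "AE \<theta> in circ. \<theta> \<notin> {\<theta>. cis \<theta> = a / \<rho>}"
        by (intro AE_circ_countable countable_cis_eq)
      hence "AE \<theta> in circ. indicator {q. polar_pt q = a} (\<rho>, \<theta>) = (0::ennreal)"
        by eventually_elim (use True in \<open>auto simp: polar_pt_def indicator_def field_simps\<close>)
      hence "(\<integral>\<^sup>+\<theta>. indicator {q. polar_pt q = a} (\<rho>, \<theta>) \<partial>circ) = (\<integral>\<^sup>+\<theta>. 0 \<partial>circ)"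
        by (rule nn_integral_cong_AE)
      thus ?thesis by simp
    qed (simp add: ennreal_neg)
  qed
  finally have "emeasure polar {q. polar_pt q = a} = 0"
    by (subst (asm) nn_integral_indicator) simp_all
  moreover have "{q. polar_pt q = a} \<in> sets polar" by measurable
  ultimately show ?thesis
    by (intro AE_I[of _ _ "{q. polar_pt q = a}"]) auto
qed

section \<open>The logarithmic potential of a disc\<close>

lemma has_integral_radial:
  fixes A P :: real
  assumes "0 \<le> A" "A \<le> P" "0 < P"
  shows "((\<lambda>\<rho>. 4 * \<rho> * (ln (2*P) - ln (max \<rho> A))) has_integral (2 * P\<^sup>2 * ln 2 + P\<^sup>2 - A\<^sup>2)) {0..P}"
proof -
  \<comment> \<open>Below A the logarithm is constant; above A the term \<rho>^2 cancels what the
    derivative of ln \<rho> produces. Subtracting A^2 gives F 0 = 0, and the two branches meet at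
    A.\<close>
  define F where "F = (\<lambda>\<rho>. 2 * \<rho>\<^sup>2 * (ln (2*P) - ln (max \<rho> A)) + (max \<rho> A)\<^sup>2 - A\<^sup>2)"
  have cont0: "continuous_on {0..P} (\<lambda>\<rho>. \<rho>\<^sup>2 * ln (max \<rho> A))"
  proof (cases "A > 0")
    case True
    thus ?thesis by (intro continuous_intros) (auto simp: max_def)
  next
    case False
    hence A: "A = 0" using assms by simp
    have "continuous (at x within {0..P}) (\<lambda>\<rho>. \<rho>\<^sup>2 * ln (max \<rho> A))" if "x \<in> {0..P}" for x
    proof (cases "x = 0")
      case True
      have "((\<lambda>\<rho>::real. \<rho>\<^sup>2 * ln \<rho>) \<longlongrightarrow> 0) (at_right 0)" by real_asymp
      moreover have "at 0 within {0..P} = at_right (0::real)"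
        by (intro at_within_Icc_at_right assms)
      moreover have "eventually (\<lambda>\<rho>. \<rho>\<^sup>2 * ln \<rho> = \<rho>\<^sup>2 * ln (max \<rho> A)) (at_right 0)"
        using A by (auto simp: eventually_at_filter)
      ultimately show ?thesis using True A
        by (auto simp: continuous_within intro: Lim_transform_eventually)
    next
      case False
      thus ?thesis using that A by (intro continuous_intros) (auto simp: max_def)
    qed
    thus ?thesis by (simp add: continuous_on_eq_continuous_within)
  qed
  have cont: "continuous_on {0..P} F"
  proof -
    have "continuous_on {0..P} (\<lambda>\<rho>. 2 * \<rho>\<^sup>2 * ln (2*P) - 2 * (\<rho>\<^sup>2 * ln (max \<rho> A)) + (max \<rho> A)\<^sup>2 - A\<^sup>2)"
      by (intro continuous_intros cont0)
    thus ?thesis by (simp add: F_def algebra_simps)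
  qed
  have "((\<lambda>\<rho>. 4 * \<rho> * (ln (2*P) - ln (max \<rho> A))) has_integral (F P - F 0)) {0..P}"
  proof (rule fundamental_theorem_of_calculus_interior_strong[where S = "{A}"])
    fix x assume x: "x \<in> {0<..<P} - {A}"
    have "(F has_real_derivative 4 * x * (ln (2*P) - ln (max x A))) (at x)"
    proof (cases "x < A")
      case True
      have "((\<lambda>\<rho>. 2 * \<rho>\<^sup>2 * (ln (2*P) - ln A) + A\<^sup>2 - A\<^sup>2) has_real_derivative 4 * x * (ln (2*P) - ln (max x A))) (at x)"
        by (rule derivative_eq_intros refl | use True in simp)+
      thus ?thesis unfolding F_def
        by (rule has_field_derivative_transform_within_open[where S = "{..<A}"]) (use True in auto)
    next
      case False
      hence "x > A" using x by auto
      have "((\<lambda>\<rho>. 2 * \<rho>\<^sup>2 * (ln (2*P) - ln \<rho>) + \<rho>\<^sup>2 - A\<^sup>2) has_real_derivative 4 * x * (ln (2*P) - ln (max x A))) (at x)"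
        by (rule derivative_eq_intros refl | use \<open>x > A\<close> assms in \<open>simp add: field_simps power2_eq_square\<close>)+
      thus ?thesis unfolding F_def
        by (rule has_field_derivative_transform_within_open[where S = "{A<..}"]) (use \<open>x > A\<close> in auto)
    qed
    thus "(F has_vector_derivative 4 * x * (ln (2*P) - ln (max x A))) (at x)"
      by (simp add: has_real_derivative_iff_has_vector_derivative)
  qed (use cont assms in auto)
  moreover have "F P - F 0 = 2 * P\<^sup>2 * ln 2 + P\<^sup>2 - A\<^sup>2"
    using assms by (simp add: F_def max_def ln_mult)
  ultimately show ?thesis by simp
qed

text \<open>\<open>mean_ln_dist\<close> settles each circle and \<open>has_integral_radial\<close>
  the radii. The shift by ln (2 P) makes the kernel nonnegative on the disc of radius P, where |w -
  a| <= 2 P, so that nonnegative integrals apply; P >= 1 covers the point w = a with its value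
  \<open>ln 0 = 0\<close>.\<close>

lemma nn_integral_polar_log_potential:
  assumes "cmod a \<le> P" "1 \<le> P"
  shows "(\<integral>\<^sup>+q. indicator {..P} (fst q) * ennreal (ln (2*P) - ln (cmod (polar_pt q - a))) \<partial>polar)
    = ennreal (2 * P\<^sup>2 * ln 2 + P\<^sup>2 - (cmod a)\<^sup>2)"
proof -
  have "(\<integral>\<^sup>+q. indicator {..P} (fst q) * ennreal (ln (2*P) - ln (cmod (polar_pt q - a))) \<partial>polar)
    = (\<integral>\<^sup>+\<rho>. ennreal (4 * \<rho>) * (\<integral>\<^sup>+\<theta>. indicator {..P} \<rho> * ennreal (ln (2*P) - ln (cmod (polar_pt (\<rho>,\<theta>) - a))) \<partial>circ) \<partial>lborel)"
    by (subst nn_integral_polar) simp_all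
  also have "\<dots> = (\<integral>\<^sup>+\<rho>. ennreal (indicator {0..P} \<rho> * (4 * \<rho> * (ln (2*P) - ln (max \<rho> (cmod a))))) \<partial>lborel)"
  proof (intro nn_integral_cong)
    fix \<rho> :: real
    show "ennreal (4 * \<rho>) * (\<integral>\<^sup>+\<theta>. indicator {..P} \<rho> * ennreal (ln (2*P) - ln (cmod (polar_pt (\<rho>,\<theta>) - a))) \<partial>circ)
      = ennreal (indicator {0..P} \<rho> * (4 * \<rho> * (ln (2*P) - ln (max \<rho> (cmod a)))))"
    proof (cases "0 < \<rho> \<and> \<rho> \<le> P")
      case True
      have pos: "0 \<le> ln (2*P) - ln (cmod (polar_pt (\<rho>,\<theta>) - a))" for \<theta>
      proof -
        have le: "cmod (polar_pt (\<rho>,\<theta>) - a) \<le> 2 * P"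
          using norm_triangle_ineq4[of "polar_pt (\<rho>,\<theta>)" a] True assms by (simp add: polar_pt_def norm_mult)
        show ?thesis
        proof (cases "polar_pt (\<rho>,\<theta>) - a = 0")
          case False
          thus ?thesis using le assms by simp
        qed (use assms in simp)
      qed
      have "has_bochner_integral circ (\<lambda>\<theta>. ln (2*P) - ln (cmod (complex_of_real \<rho> * cis \<theta> - a)))
          (ln (2*P) - ln (max \<rho> (cmod a)))"
        by (intro has_bochner_integral_diff mean_ln_dist has_bochner_integral_circ_const) (use True in auto)
      hence hb: "has_bochner_integral circ (\<lambda>\<theta>. ln (2*P) - ln (cmod (polar_pt (\<rho>,\<theta>) - a))) (ln (2*P) - ln (max \<rho> (cmod a)))"
        by (simp add: polar_pt_def)
      have "(\<integral>\<^sup>+\<theta>. indicator {..P} \<rho> * ennreal (ln (2*P) - ln (cmod (polar_pt (\<rho>,\<theta>) - a))) \<partial>circ)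
          = (\<integral>\<^sup>+\<theta>. ennreal (ln (2*P) - ln (cmod (polar_pt (\<rho>,\<theta>) - a))) \<partial>circ)"
        using True by simp
      also have "\<dots> = ennreal (ln (2*P) - ln (max \<rho> (cmod a)))"
        using nn_integral_eq_integral[of circ "\<lambda>\<theta>. ln (2*P) - ln (cmod (polar_pt (\<rho>,\<theta>) - a))"] hb pos
        by (simp add: has_bochner_integral_iff)
      finally show ?thesis using True by (simp add: ennreal_mult')
    next
      case False
      hence "4 * \<rho> \<le> 0 \<or> indicator {..P} \<rho> = (0::ennreal)" by auto
      with False show ?thesis by (auto simp: ennreal_neg indicator_def split: if_splits)
    qed
  qed
  also have "\<dots> = ennreal (2 * P\<^sup>2 * ln 2 + P\<^sup>2 - (cmod a)\<^sup>2)"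
  proof (rule nn_integral_has_integral_lebesgue)
    fix \<rho> :: real assume \<rho>: "\<rho> \<in> {0..P}"
    have "0 \<le> ln (2*P) - ln (max \<rho> (cmod a))"
    proof (cases "max \<rho> (cmod a) > 0")
      case False
      hence "max \<rho> (cmod a) = 0" using \<rho> by (simp add: max_def split: if_splits)
      thus ?thesis using assms by simp
    qed (use \<rho> assms in simp)
    thus "0 \<le> 4 * \<rho> * (ln (2*P) - ln (max \<rho> (cmod a)))" using \<rho> by simp
  qed (rule has_integral_radial; use assms in simp)
  finally show ?thesis .
qed

text \<open>Jensen's term as a function of the omitted value. It is defined by the integral and not
  by zeros: the two agree for almost every q, and the integral is visibly measurable in q and in the
  radius.\<close>

definition jensen :: "(complex \<Rightarrow> complex) \<Rightarrow> real \<Rightarrow> real \<times> real \<Rightarrow> real" where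
  "jensen f r q = (\<integral>t. ln (cmod (f (complex_of_real r * cis t) - polar_pt q)) \<partial>circ) - ln (cmod (f 0 - polar_pt q))"

lemma measurable_jensen:
  assumes "f holomorphic_on ball 0 R" "0 < r" "r < R"
  shows "jensen f r \<in> borel_measurable polar"
proof -
  define F where "F = (\<lambda>t. f (complex_of_real r * cis t))"
  have "continuous_on UNIV F" unfolding F_def
    by (intro continuous_intros continuous_on_compose2[OF holomorphic_on_imp_continuous_on[OF assms(1)]])
       (use assms in \<open>auto simp: norm_mult\<close>)
  hence [measurable]: "F \<in> borel_measurable borel" by (rule borel_measurable_continuous_onI)
  have "jensen f r = (\<lambda>q. (\<integral>t. ln (cmod (F t - polar_pt q)) \<partial>circ) - ln (cmod (f 0 - polar_pt q)))"
    by (simp add: fun_eq_iff jensen_def F_def)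
  thus ?thesis by simp
qed

lemma jensen_eq_zero_count:
  assumes "f holomorphic_on ball 0 R" "0 < r" "r < R" "polar_pt q \<noteq> f 0"
  shows "jensen f r q = zero_count (\<lambda>z. f z - polar_pt q) r"
proof -
  have "has_bochner_integral circ (\<lambda>t. ln (cmod (f (complex_of_real r * cis t) - polar_pt q)))
      (ln (cmod (f 0 - polar_pt q)) + zero_count (\<lambda>z. f z - polar_pt q) r)"
    by (rule Jensen(1)) (use assms in \<open>auto intro!: holomorphic_intros\<close>)
  thus ?thesis by (simp add: jensen_def has_bochner_integral_integral_eq)
qed

lemma zero_count_nonneg:
  assumes "f holomorphic_on ball 0 R" "f 0 \<noteq> 0" "0 < r" "r < R"
  shows "zero_count f r \<ge> 0"
  unfolding zero_count_def
proof (rule sum_nonneg)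
  fix z assume z: "z \<in> {z \<in> cball 0 r. f z = 0}"
  have "zorder f z \<ge> 0"
    by (rule zorder_nonneg[OF assms(1) open_ball connected_ball _ _ assms(2)]) (use z assms in auto)
  moreover have "z \<noteq> 0" using z assms by auto
  ultimately show "0 \<le> zorder f z * ln (r / cmod z)" using z by simp
qed

text \<open>The squared modulus is, up to a constant, the logarithmic potential of the planar measure,
  so integrating Jensen's formula over the omitted value gives the growth of the square means.\<close>
theorem nn_integral_jensen:
  assumes f: "f holomorphic_on ball 0 R" and r: "0 < r" "r < R"
  shows "(\<integral>\<^sup>+q. ennreal (jensen f r q) \<partial>polar) = ennreal (circle_mean2 f r - (cmod (f 0))\<^sup>2)"
proof -
  have contf: "continuous_on (cball 0 r) f"
    by (rule holomorphic_on_imp_continuous_on[OF holomorphic_on_subset[OF f]]) (use r in auto)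
  obtain P0 where P0: "\<And>z. z \<in> cball 0 r \<Longrightarrow> cmod (f z) \<le> P0"
    using compact_imp_bounded[OF compact_continuous_image[OF contf compact_cball]] by (auto simp: bounded_iff) (metis mem_cball_0)
  \<comment> \<open>P exceeds |f| on the closed disc, so values \<alpha> beyond P are not taken
    there and contribute nothing; the summand 1 secures P >= 1.\<close>
  define P where "P = max P0 0 + 1"
  have P: "P \<ge> 1" "\<And>z. z \<in> cball 0 r \<Longrightarrow> cmod (f z) < P" using P0 by (fastforce simp: P_def)+
  define F where "F = (\<lambda>t. f (complex_of_real r * cis t))"
  have Fc: "continuous_on UNIV F" unfolding F_def
    by (intro continuous_intros continuous_on_compose2[OF contf]) (use r in \<open>auto simp: norm_mult\<close>)
  have [measurable]: "F \<in> borel_measurable borel" by (rule borel_measurable_continuous_onI[OF Fc])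
  have FP: "cmod (F t) < P" for t unfolding F_def by (rule P(2)) (use r in \<open>simp add: norm_mult\<close>)
  let ?k = "\<lambda>q a. ln (2*P) - ln (cmod (polar_pt q - a))"
  let ?I = "\<lambda>q. indicator {..P} (fst q) :: ennreal"
  define c where "c = 2 * P\<^sup>2 * ln 2 + P\<^sup>2"
  note [measurable] = measurable_jensen[OF f r]
  have kpos: "?k q a \<ge> 0" if "fst q \<le> P" "fst q \<ge> 0" "cmod a \<le> P" for q a
  proof (cases "polar_pt q - a = 0")
    case False
    have "cmod (polar_pt q - a) \<le> 2 * P"
      using norm_triangle_ineq4[of "polar_pt q" a] that by (simp add: polar_pt_def norm_mult)
    thus ?thesis using False P(1) by simp
  qed (use P in simp)
  have AE0: "AE q in polar. fst q \<ge> 0"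
  proof -
    have "(\<integral>\<^sup>+q. indicator {q. fst q < 0} q \<partial>polar)
        = (\<integral>\<^sup>+\<rho>. ennreal (4 * \<rho>) * (\<integral>\<^sup>+\<theta>. indicator {q. fst q < (0::real)} (\<rho>, \<theta>::real) \<partial>circ) \<partial>lborel)"
      by (rule nn_integral_polar) measurable
    also have "\<dots> = (\<integral>\<^sup>+\<rho>. 0 \<partial>(lborel::real measure))"
      by (intro nn_integral_cong) (auto simp: indicator_def ennreal_neg)
    finally have "emeasure polar {q. fst q < 0} = 0"
      by (subst (asm) nn_integral_indicator) simp_all
    moreover have "{q. fst q < 0} \<in> sets polar" by measurable
    ultimately show ?thesis by (intro AE_I[of _ _ "{q. fst q < 0}"]) auto
  qed
  \<comment> \<open>Subtracted from ln (2 P), Jensen's formula becomes a sum of nonnegative terms: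
    the zero count plus the mean of the kernel along f is the kernel at f 0. The additive form
    avoids the truncated subtraction of extended reals.\<close>
  have AEj: "AE q in polar. ennreal (jensen f r q) = ?I q * ennreal (jensen f r q) \<and>
      ?I q * ennreal (jensen f r q) + (\<integral>\<^sup>+t. ?I q * ennreal (?k q (F t)) \<partial>circ) = ?I q * ennreal (?k q (f 0))"
    using AE_polar_neq[of "f 0"] AE0
  proof eventually_elim
    case (elim q)
    have hol: "(\<lambda>z. f z - polar_pt q) holomorphic_on ball 0 R" by (intro holomorphic_intros f)
    have nz: "f 0 - polar_pt q \<noteq> 0" using elim by auto
    have je: "jensen f r q = zero_count (\<lambda>z. f z - polar_pt q) r"
      by (rule jensen_eq_zero_count[OF f r elim(1)])
    show ?case
    proof (cases "fst q \<le> P")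
      case False
      have "cmod (polar_pt q) > P" using False elim by (simp add: polar_pt_def norm_mult)
      hence "{z \<in> cball 0 r. f z - polar_pt q = 0} = {}" using P(2) by force
      hence "jensen f r q = 0" unfolding je zero_count_def by (simp only: sum.empty)
      thus ?thesis using False by simp
    next
      case True
      have jpos: "jensen f r q \<ge> 0" unfolding je by (rule zero_count_nonneg[OF hol nz r])
      have "has_bochner_integral circ (\<lambda>t. ln (cmod (f (complex_of_real r * cis t) - polar_pt q)))
        (ln (cmod (f 0 - polar_pt q)) + jensen f r q)"
        unfolding je by (rule Jensen(1)[OF hol nz r])
      hence "has_bochner_integral circ (\<lambda>t. ln (2*P) - ln (cmod (F t - polar_pt q)))
        (ln (2*P) - (ln (cmod (f 0 - polar_pt q)) + jensen f r q))"
        unfolding F_def by (intro has_bochner_integral_diff has_bochner_integral_circ_const) auto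
      hence hb: "has_bochner_integral circ (\<lambda>t. ?k q (F t)) (?k q (f 0) - jensen f r q)"
        by (simp add: norm_minus_commute diff_diff_add)
      have pos: "?k q (F t) \<ge> 0" for t by (rule kpos) (use True elim FP[of t] in auto)
      have "(\<integral>\<^sup>+t. ?I q * ennreal (?k q (F t)) \<partial>circ) = (\<integral>\<^sup>+t. ennreal (?k q (F t)) \<partial>circ)"
        using True by simp
      also have "\<dots> = ennreal (?k q (f 0) - jensen f r q)"
        using nn_integral_eq_integral[of circ "\<lambda>t. ?k q (F t)"] hb pos by (simp add: has_bochner_integral_iff)
      moreover have "?k q (f 0) - jensen f r q \<ge> 0"
        using hb integral_nonneg_AE[of "\<lambda>t. ?k q (F t)" circ] pos by (simp add: has_bochner_integral_iff)
      ultimately show ?thesis using True jpos by (simp add: ennreal_plus[symmetric] del: ennreal_plus)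
    qed
  qed
  have "(\<integral>\<^sup>+q. ennreal (jensen f r q) \<partial>polar) + (\<integral>\<^sup>+q. (\<integral>\<^sup>+t. ?I q * ennreal (?k q (F t)) \<partial>circ) \<partial>polar)
    = (\<integral>\<^sup>+q. ?I q * ennreal (jensen f r q) \<partial>polar) + (\<integral>\<^sup>+q. (\<integral>\<^sup>+t. ?I q * ennreal (?k q (F t)) \<partial>circ) \<partial>polar)"
    by (intro arg_cong2[where f="(+)"] refl nn_integral_cong_AE) (use AEj in \<open>auto elim!: eventually_mono\<close>)
  also have "\<dots> = (\<integral>\<^sup>+q. ?I q * ennreal (jensen f r q) + (\<integral>\<^sup>+t. ?I q * ennreal (?k q (F t)) \<partial>circ) \<partial>polar)"
    by (rule nn_integral_add[symmetric]) measurable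
  also have "\<dots> = (\<integral>\<^sup>+q. ?I q * ennreal (?k q (f 0)) \<partial>polar)"
    by (intro nn_integral_cong_AE) (use AEj in \<open>auto elim!: eventually_mono\<close>)
  also have "\<dots> = ennreal (c - (cmod (f 0))\<^sup>2)"
    unfolding c_def by (rule nn_integral_polar_log_potential) (use P(1) P(2)[of 0] r in auto)
  finally have 1: "(\<integral>\<^sup>+q. ennreal (jensen f r q) \<partial>polar) + (\<integral>\<^sup>+q. (\<integral>\<^sup>+t. ?I q * ennreal (?k q (F t)) \<partial>circ) \<partial>polar)
    = ennreal (c - (cmod (f 0))\<^sup>2)" .
  \<comment> \<open>After Fubini the integral over \<alpha> is once more a logarithmic potential,
    now at the points F t of the image of the circle.\<close>
  have "(\<integral>\<^sup>+q. (\<integral>\<^sup>+t. ?I q * ennreal (?k q (F t)) \<partial>circ) \<partial>polar) = (\<integral>\<^sup>+t. (\<integral>\<^sup>+q. ?I q * ennreal (?k q (F t)) \<partial>polar) \<partial>circ)"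
    by (rule polar_circ.Fubini'[symmetric]) measurable
  also have "\<dots> = (\<integral>\<^sup>+t. ennreal (c - (cmod (F t))\<^sup>2) \<partial>circ)"
    unfolding c_def by (intro nn_integral_cong nn_integral_polar_log_potential) (use P(1) FP less_imp_le in auto)
  also have "\<dots> = ennreal (c - circle_mean2 f r)"
  proof -
    have "has_bochner_integral circ (\<lambda>t. c - (cmod (F t))\<^sup>2) (c - circle_mean2 f r)"
      unfolding F_def by (intro has_bochner_integral_diff circle_mean2_circ has_bochner_integral_circ_const)
        (use r continuous_on_subset[OF contf] in \<open>auto simp: sphere_cball\<close>)
    moreover have "c - (cmod (F t))\<^sup>2 \<ge> 0" for t
    proof -
      have "(cmod (F t))\<^sup>2 \<le> P\<^sup>2" using FP[of t] by (intro power_mono) auto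
      thus ?thesis using P by (simp add: c_def add_increasing)
    qed
    ultimately show ?thesis
      using nn_integral_eq_integral[of circ "\<lambda>t. c - (cmod (F t))\<^sup>2"] by (simp add: has_bochner_integral_iff)
  qed
  finally have 2: "(\<integral>\<^sup>+q. (\<integral>\<^sup>+t. ?I q * ennreal (?k q (F t)) \<partial>circ) \<partial>polar) = ennreal (c - circle_mean2 f r)" .
  show ?thesis
  proof -
    \<comment> \<open>The number c - \<open>circle_mean2 f r\<close> has to be nonnegative for the
      difference of extended reals to be the difference of real numbers.\<close>
    have "circle_mean2 f r \<le> c"
    proof -
      have "has_bochner_integral circ (\<lambda>t. (cmod (F t))\<^sup>2) (circle_mean2 f r)"
        unfolding F_def by (intro circle_mean2_circ) (use r continuous_on_subset[OF contf] in auto)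
      moreover have "has_bochner_integral circ (\<lambda>t. c) c"
        by (rule has_bochner_integral_circ_const)
      moreover have "(cmod (F t))\<^sup>2 \<le> c" for t
      proof -
        have "(cmod (F t))\<^sup>2 \<le> P\<^sup>2" using FP[of t] by (intro power_mono) auto
        thus ?thesis using P by (simp add: c_def add_increasing)
      qed
      ultimately show ?thesis
        using integral_mono[of circ "\<lambda>t. (cmod (F t))\<^sup>2" "\<lambda>_. c"] circ.prob_space by (simp add: has_bochner_integral_iff)
    qed
    hence "ennreal (c - (cmod (f 0))\<^sup>2) - ennreal (c - circle_mean2 f r) = ennreal (circle_mean2 f r - (cmod (f 0))\<^sup>2)"
      by (subst ennreal_minus) auto
    moreover have "(\<integral>\<^sup>+q. ennreal (jensen f r q) \<partial>polar) = ennreal (c - (cmod (f 0))\<^sup>2) - ennreal (c - circle_mean2 f r)"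
      using 1 unfolding 2 by (metis ennreal_add_diff_cancel_right ennreal_neq_top)
    ultimately show ?thesis by simp
  qed
qed

section \<open>Hardy space estimates\<close>

definition taylor_coeff :: "(complex \<Rightarrow> complex) \<Rightarrow> nat \<Rightarrow> complex" where
  "taylor_coeff f k = (deriv ^^ k) f 0 / fact k"

lemma has_bochner_integral_circ_coeff:
  assumes "f holomorphic_on ball 0 R" "0 < r" "r < R"
  shows "has_bochner_integral circ
    (\<lambda>t. f (complex_of_real r * cis t) / (complex_of_real r * cis t) ^ k) (taylor_coeff f k)"
proof -
  have contf: "continuous_on (cball 0 r) f"
    by (rule holomorphic_on_imp_continuous_on[OF holomorphic_on_subset[OF assms(1)]]) (use assms in auto)
  have ci: "((\<lambda>u. f u / (u - 0) ^ Suc k) has_contour_integral (2 * pi * \<i>) / fact k * (deriv ^^ k) f 0) (circlepath 0 r)"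
    by (rule Cauchy_has_contour_integral_higher_derivative_circlepath[OF contf])
       (use assms in \<open>auto intro: holomorphic_on_subset[OF assms(1)]\<close>)
  have "continuous_on (sphere 0 r) (\<lambda>u. f u / (u - 0) ^ Suc k)"
    using assms by (intro continuous_intros continuous_on_subset[OF contf]) auto
  from has_bochner_integral_circ_contour[OF this assms(2) ci] show ?thesis
    using assms(2) by (simp add: taylor_coeff_def field_simps)
qed

text \<open>Only one factor of the product of f and its conjugate is expanded into a Taylor series.
  Cauchy's formula integrates each term against the other factor to a conjugate coefficient, so a
  single series remains.\<close>

theorem Parseval:
  assumes f: "f holomorphic_on ball 0 R" "0 < r" "r < R"
  shows "(\<lambda>k. (cmod (taylor_coeff f k))\<^sup>2 * r ^ (2 * k)) sums circle_mean2 f r"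
proof -
  have contf: "continuous_on (cball 0 r) f"
    by (rule holomorphic_on_imp_continuous_on[OF holomorphic_on_subset[OF f(1)]]) (use f in auto)
  obtain B where B: "\<And>z. z \<in> cball 0 r \<Longrightarrow> cmod (f z) \<le> B"
    using compact_imp_bounded[OF compact_continuous_image[OF contf compact_cball]]
    by (auto simp: bounded_iff) (metis mem_cball_0)
  let ?c = "\<lambda>t. complex_of_real r * cis t"
  have cb: "?c t \<in> cball 0 r" for t using f by (simp add: norm_mult)
  define h where "h = (\<lambda>k t. taylor_coeff f k * (?c t) ^ k * cnj (f (?c t)))"
  have ser: "(\<lambda>k. taylor_coeff f k * w ^ k) sums f w" if "w \<in> cball 0 r" for w
    using holomorphic_power_series[OF f(1), of w] that f by (simp add: taylor_coeff_def)
  have hb: "has_bochner_integral circ (h k) (of_real ((cmod (taylor_coeff f k))\<^sup>2 * r ^ (2 * k)))" for k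
  proof -
    \<comment> \<open>On |z| = r one has z^k = r^(2k) / (cnj z)^k, which brings the k-th term into
      the form of a conjugated coefficient integral.\<close>
    have "has_bochner_integral circ (\<lambda>t. (taylor_coeff f k * of_real (r ^ (2*k))) * cnj (f (?c t) / (?c t) ^ k))
       ((taylor_coeff f k * of_real (r ^ (2*k))) * cnj (taylor_coeff f k))"
      by (intro has_bochner_integral_mult_right has_bochner_integral_cnj has_bochner_integral_circ_coeff[OF f])
    moreover have "(taylor_coeff f k * of_real (r ^ (2*k))) * cnj (f (?c t) / (?c t) ^ k) = h k t" for t
    proof -
      have "cnj (?c t) ^ k * ?c t ^ k = of_real (r ^ (2 * k))"
      proof -
        have "cnj (?c t) * ?c t = of_real (r\<^sup>2)"
          by (simp add: complex_norm_square[symmetric] norm_mult mult.commute[of "cnj _"] del: complex_cnj_mult of_real_power)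
        thus ?thesis by (simp only: power_mult_distrib[symmetric] power_mult of_real_power)
      qed
      thus ?thesis using f by (simp add: h_def field_simps)
    qed
    moreover have "(taylor_coeff f k * of_real (r ^ (2*k))) * cnj (taylor_coeff f k) = of_real ((cmod (taylor_coeff f k))\<^sup>2 * r ^ (2 * k))"
      by (simp add: complex_norm_square del: of_real_power)
    ultimately show ?thesis by (simp only:)
  qed
  have sa: "summable (\<lambda>k. cmod (taylor_coeff f k) * r ^ k)"
  proof -
    \<comment> \<open>Convergence at a radius s > r makes the series converge absolutely on |z| = r,
      as termwise integration demands.\<close>
    obtain s where s: "r < s" "s < R" using f dense by blast
    have "summable (\<lambda>k. taylor_coeff f k * of_real s ^ k)"
      using holomorphic_power_series[OF f(1), of "of_real s"] s f by (auto simp: taylor_coeff_def sums_iff)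
    from powser_insidea[OF this, of "of_real r"] s f show ?thesis
      by (simp add: norm_mult norm_power)
  qed
  have nh: "cmod (h k t) \<le> cmod (taylor_coeff f k) * r ^ k * B" for k t
    using B[OF cb[of t]] f by (simp add: h_def norm_mult norm_power mult_left_mono)
  have "(\<lambda>k. integral\<^sup>L circ (h k)) sums (\<integral>t. (\<Sum>k. h k t) \<partial>circ)"
  proof (rule sums_integral)
    show "integrable circ (h k)" for k using hb by (simp add: has_bochner_integral_iff)
    show "AE t in circ. summable (\<lambda>k. norm (h k t))"
      by (intro AE_I2 summable_comparison_test'[OF summable_mult2[OF sa, of B]]) (use nh in auto)
    show "summable (\<lambda>k. \<integral>t. norm (h k t) \<partial>circ)"
    proof (rule summable_comparison_test'[OF summable_mult2[OF sa, of B]])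
      fix k
      have "(\<integral>t. norm (h k t) \<partial>circ) \<le> (\<integral>t. cmod (taylor_coeff f k) * r ^ k * B \<partial>circ)"
        by (intro integral_mono) (use hb[of k] nh in \<open>auto simp: has_bochner_integral_iff\<close>)
      thus "norm (\<integral>t. norm (h k t) \<partial>circ) \<le> cmod (taylor_coeff f k) * r ^ k * B"
        using circ.prob_space by simp
    qed
  qed
  moreover have "(\<Sum>k. h k t) = of_real ((cmod (f (?c t)))\<^sup>2)" for t
    using sums_mult2[OF ser[OF cb[of t]], of "cnj (f (?c t))"]
    by (simp add: h_def sums_iff complex_norm_square del: of_real_power)
  moreover have "(\<integral>t. complex_of_real ((cmod (f (?c t)))\<^sup>2) \<partial>circ) = circle_mean2 f r"
    using circle_mean2_circ[of r f] continuous_on_subset[OF contf, of "sphere 0 r"] f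
    by (simp add: has_bochner_integral_iff sphere_cball del: of_real_power)
  ultimately have "(\<lambda>k. complex_of_real ((cmod (taylor_coeff f k))\<^sup>2 * r ^ (2 * k))) sums complex_of_real (circle_mean2 f r)"
    by (simp only: has_bochner_integral_integral_eq[OF hb])
  thus ?thesis by (rule sums_of_real_iff[THEN iffD1])
qed

section \<open>Coefficients and growth of Hardy functions\<close>

lemma circle_mean2_le_H2_norm2:
  assumes "f \<in> H2" "0 < r" "r < 1"
  shows "circle_mean2 f r \<le> H2_norm2 f"
  unfolding H2_norm2_def by (rule cSUP_upper) (use assms in \<open>auto simp: H2_def\<close>)

lemma H2_coeffs:
  assumes "f \<in> H2"
  shows "summable (\<lambda>k. (cmod (taylor_coeff f k))\<^sup>2)" "(\<Sum>k. (cmod (taylor_coeff f k))\<^sup>2) \<le> H2_norm2 f"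
proof -
  have hol: "f holomorphic_on ball 0 1" using assms by (simp add: H2_def)
  have le: "(\<Sum>k<N. (cmod (taylor_coeff f k))\<^sup>2) \<le> H2_norm2 f" for N
  proof (rule tendsto_upperbound)
    have "((\<lambda>r. \<Sum>k<N. (cmod (taylor_coeff f k))\<^sup>2 * r ^ (2 * k)) \<longlongrightarrow> (\<Sum>k<N. (cmod (taylor_coeff f k))\<^sup>2 * 1 ^ (2 * k))) (at_left 1)"
      by (intro tendsto_intros)
    thus "((\<lambda>r. \<Sum>k<N. (cmod (taylor_coeff f k))\<^sup>2 * r ^ (2 * k)) \<longlongrightarrow> (\<Sum>k<N. (cmod (taylor_coeff f k))\<^sup>2)) (at_left (1::real))"
      by simp
    have "eventually (\<lambda>r. r \<in> {0<..<1}) (at_left (1::real))"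
      by (rule eventually_at_leftI[of 0]) auto
    thus "eventually (\<lambda>r. (\<Sum>k<N. (cmod (taylor_coeff f k))\<^sup>2 * r ^ (2 * k)) \<le> H2_norm2 f) (at_left (1::real))"
    proof eventually_elim
      case (elim r)
      have s: "(\<lambda>k. (cmod (taylor_coeff f k))\<^sup>2 * r ^ (2 * k)) sums circle_mean2 f r"
        by (rule Parseval[OF hol]) (use elim in auto)
      have "(\<Sum>k<N. (cmod (taylor_coeff f k))\<^sup>2 * r ^ (2 * k)) \<le> circle_mean2 f r"
        using sum_le_suminf[of "\<lambda>k. (cmod (taylor_coeff f k))\<^sup>2 * r ^ (2 * k)" "{..<N}"] s elim
        by (simp add: sums_iff)
      also have "\<dots> \<le> H2_norm2 f" using circle_mean2_le_H2_norm2[OF assms] elim by auto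
      finally show ?case .
    qed
  qed auto
  show sm: "summable (\<lambda>k. (cmod (taylor_coeff f k))\<^sup>2)"
    by (rule summableI_nonneg_bounded[OF _ le]) auto
  show "(\<Sum>k. (cmod (taylor_coeff f k))\<^sup>2) \<le> H2_norm2 f"
    by (rule suminf_le_const[OF sm le])
qed

lemma H2_norm2_nonneg:
  assumes "f \<in> H2" shows "H2_norm2 f \<ge> 0"
  using H2_coeffs[OF assms] suminf_nonneg[of "\<lambda>k. (cmod (taylor_coeff f k))\<^sup>2"] by force

text \<open>Cauchy's formula for f^2 brings in the square mean at once. The radius halfway between
  |w| and 1 is responsible for the factor 2.\<close>

lemma H2_growth:
  assumes "f \<in> H2" "cmod w < 1"
  shows "(cmod (f w))\<^sup>2 \<le> 2 * H2_norm2 f / (1 - cmod w)"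
proof -
  define R where "R = (1 + cmod w) / 2"
  have R: "0 < R" "R < 1" "cmod w < R" using assms by (auto simp: R_def intro: add_pos_nonneg)
  have hol: "f holomorphic_on ball 0 1" using assms by (simp add: H2_def)
  let ?c = "\<lambda>t. complex_of_real R * cis t"
  have c: "cmod (?c t) = R" for t using R by (simp add: norm_mult)
  have "has_bochner_integral circ (\<lambda>t. (f (?c t))\<^sup>2 * ?c t / (?c t - w)) ((f w)\<^sup>2)"
    by (rule has_bochner_integral_circ_Cauchy[of "\<lambda>z. (f z)\<^sup>2" 1]) (use R hol in \<open>auto intro!: holomorphic_intros\<close>)
  hence "cmod ((f w)\<^sup>2) \<le> (\<integral>t. cmod ((f (?c t))\<^sup>2 * ?c t / (?c t - w)) \<partial>circ)"
    and i: "integrable circ (\<lambda>t. cmod ((f (?c t))\<^sup>2 * ?c t / (?c t - w)))"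
    using integral_norm_bound[of circ "\<lambda>t. (f (?c t))\<^sup>2 * ?c t / (?c t - w)"]
    by (auto simp: has_bochner_integral_iff)
  note this(1)
  also have "(\<integral>t. cmod ((f (?c t))\<^sup>2 * ?c t / (?c t - w)) \<partial>circ) \<le> (\<integral>t. (cmod (f (?c t)))\<^sup>2 * (R / (R - cmod w)) \<partial>circ)"
  proof (rule integral_mono[OF i])
    have cont: "continuous_on (sphere 0 R) f"
      by (rule holomorphic_on_imp_continuous_on[OF holomorphic_on_subset[OF hol]]) (use R in auto)
    show "integrable circ (\<lambda>t. (cmod (f (?c t)))\<^sup>2 * (R / (R - cmod w)))"
      using circle_mean2_circ[OF cont] R by (intro integrable_mult_left) (auto simp: has_bochner_integral_iff)
    fix t
    have "R - cmod w \<le> cmod (?c t - w)" using norm_triangle_ineq2[of "?c t" w] c[of t] by simp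
    hence "R / cmod (?c t - w) \<le> R / (R - cmod w)" using R by (intro divide_left_mono mult_pos_pos) auto
    hence "(cmod (f (?c t)))\<^sup>2 * (R / cmod (?c t - w)) \<le> (cmod (f (?c t)))\<^sup>2 * (R / (R - cmod w))"
      by (intro mult_left_mono) auto
    thus "cmod ((f (?c t))\<^sup>2 * ?c t / (?c t - w)) \<le> (cmod (f (?c t)))\<^sup>2 * (R / (R - cmod w))"
      using c[of t] by (simp add: norm_mult norm_divide norm_power)
  qed
  also have "\<dots> = circle_mean2 f R * (R / (R - cmod w))"
  proof -
    have cont: "continuous_on (sphere 0 R) f"
      by (rule holomorphic_on_imp_continuous_on[OF holomorphic_on_subset[OF hol]]) (use R in auto)
    show ?thesis using circle_mean2_circ[OF cont] R by (simp add: has_bochner_integral_iff)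
  qed
  also have "\<dots> \<le> H2_norm2 f * (2 / (1 - cmod w))"
  proof (rule mult_mono)
    have "R - cmod w = (1 - cmod w) / 2" by (simp add: R_def field_simps)
    hence "R / (R - cmod w) = 2 * R / (1 - cmod w)" by (simp only:) (simp add: field_simps)
    also have "\<dots> \<le> 2 / (1 - cmod w)" using R assms by (intro divide_right_mono) auto
    finally show "R / (R - cmod w) \<le> 2 / (1 - cmod w)" .
  qed (use circle_mean2_le_H2_norm2[OF assms(1)] H2_norm2_nonneg[OF assms(1)] R in auto)
  finally show ?thesis by (simp add: norm_power mult.commute)
qed

text \<open>Cauchy's inequality on discs of radius (1 - \<rho>) / 2, on which
  \<open>H2_growth\<close> is uniform. It serves on compact subsets of the disc, where the growth
  condition gives no information.\<close>

lemma H2_deriv_growth: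
  assumes "f \<in> H2" "cmod w \<le> \<rho>" "\<rho> < 1"
  shows "(cmod ((deriv ^^ n) f w))\<^sup>2 \<le> (fact n)\<^sup>2 * (4 / (1 - \<rho>)) / ((1 - \<rho>) / 2) ^ (2 * n) * H2_norm2 f"
proof -
  define e where "e = (1 - \<rho>) / 2"
  have e: "e > 0" using assms by (simp add: e_def)
  have hol: "f holomorphic_on ball 0 1" using assms by (simp add: H2_def)
  have sub: "cball w e \<subseteq> ball 0 1"
  proof
    fix x assume "x \<in> cball w e"
    hence "cmod x \<le> cmod w + e" using norm_triangle_ineq2[of x w] by (simp add: dist_norm norm_minus_commute)
    thus "x \<in> ball 0 1" using assms by (simp add: e_def field_simps)
  qed
  define B where "B = sqrt (4 / (1 - \<rho>) * H2_norm2 f)"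
  have "cmod ((deriv ^^ n) f w) \<le> fact n * B / e ^ n"
  proof (rule Cauchy_inequality)
    show "f holomorphic_on ball w e" "continuous_on (cball w e) f"
      using holomorphic_on_subset[OF hol] sub ball_subset_cball[of w e]
      by (blast intro: holomorphic_on_imp_continuous_on)+
    fix x assume "cmod (w - x) = e"
    hence "cmod x \<le> cmod w + e" using norm_triangle_ineq2[of x w] by (simp add: norm_minus_commute)
    hence x: "cmod x \<le> (1 + \<rho>) / 2" using assms by (simp add: e_def field_simps)
    have "(cmod (f x))\<^sup>2 \<le> 2 * H2_norm2 f / (1 - cmod x)"
      by (rule H2_growth) (use assms x in auto)
    also have "\<dots> \<le> 2 * H2_norm2 f / ((1 - \<rho>) / 2)"
      using x assms H2_norm2_nonneg[OF assms(1)] by (intro divide_left_mono mult_pos_pos) auto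
    finally show "cmod (f x) \<le> B" unfolding B_def by (intro real_le_rsqrt) (simp add: field_simps)
  qed (use e in auto)
  hence "(cmod ((deriv ^^ n) f w))\<^sup>2 \<le> (fact n * B / e ^ n)\<^sup>2" by (intro power_mono) auto
  also have "B\<^sup>2 = 4 / (1 - \<rho>) * H2_norm2 f"
    unfolding B_def using assms H2_norm2_nonneg[OF assms(1)] by (intro real_sqrt_pow2) auto
  hence "(fact n * B / e ^ n)\<^sup>2 = (fact n)\<^sup>2 * (4 / (1 - \<rho>)) / ((1 - \<rho>) / 2) ^ (2 * n) * H2_norm2 f"
    by (simp add: power_mult_distrib power_divide e_def[symmetric] power_mult[symmetric] mult.commute)
  finally show ?thesis .
qed

section \<open>Weighted integrals of square means\<close>

lemma nn_integral_power_exp: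
  assumes "c > 0"
  shows "(\<integral>\<^sup>+u. ennreal (u ^ m * exp (- c * u)) * indicator {0..} u \<partial>lborel) = ennreal (fact m / c ^ Suc m)"
proof -
  let ?I = "\<integral>\<^sup>+u. ennreal (u ^ m * exp (- c * u)) * indicator {0..} u \<partial>lborel"
  have "ennreal (fact m) = (\<integral>\<^sup>+x. ennreal (x^m * exp (-x)) * indicator {0 ..} x \<partial>lborel)"
    by (simp add: nn_intergal_power_times_exp_Ici)
  also have "\<dots> = ennreal \<bar>c\<bar> * (\<integral>\<^sup>+x. ennreal ((0 + c * x)^m * exp (-(0 + c * x))) * indicator {0 ..} (0 + c * x) \<partial>lborel)"
    by (rule nn_integral_real_affine) (use assms in auto)
  also have "\<dots> = ennreal c * (\<integral>\<^sup>+x. ennreal (c ^ m) * (ennreal (x ^ m * exp (- c * x)) * indicator {0..} x) \<partial>lborel)"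
  proof -
    have "(c * x) ^ m * exp (- (c * x)) = c ^ m * (x ^ m * exp (- c * x))" for x by (simp add: power_mult_distrib)
    hence "ennreal ((0 + c * x)^m * exp (-(0 + c * x))) * indicator {0 ..} (0 + c * x)
       = ennreal (c ^ m) * (ennreal (x ^ m * exp (- c * x)) * indicator {0..} x)"
      for x
      using assms by (auto simp: indicator_def ennreal_mult'[symmetric] zero_le_mult_iff simp del: ennreal_mult')
    thus ?thesis using assms by simp
  qed
  also have "\<dots> = ennreal c * (ennreal (c ^ m) * ?I)"
    by (subst nn_integral_cmult) auto
  also have "\<dots> = ennreal (c ^ Suc m) * ?I"
    using assms by (simp add: ennreal_mult' mult.assoc)
  finally have "ennreal (fact m) = ennreal (c ^ Suc m) * ?I" .
  hence "ennreal (1 / c ^ Suc m) * ennreal (fact m) = ennreal (1 / c ^ Suc m) * ennreal (c ^ Suc m) * ?I"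
    by (simp add: mult.assoc)
  also have "ennreal (1 / c ^ Suc m) * ennreal (c ^ Suc m) = 1"
    using assms by (subst ennreal_mult'[symmetric]) auto
  finally show ?thesis using assms by (subst (asm) ennreal_mult'[symmetric]) (auto simp: field_simps)
qed

lemma taylor_coeff_deriv:
  "taylor_coeff ((deriv ^^ n) f) k = taylor_coeff f (k + n) * (fact (k + n) / fact k)"
  by (simp add: taylor_coeff_def funpow_add o_def)

text \<open>By Parseval the square mean at radius e^(-u) is a series in e^(-2ku), and the weight
  integrates e^(-2ku) to (2n-1)! / (2k)^(2n). This cancels the square of the factor (k+n)! / k!
  produced by differentiation. Subtracting the value at 0 removes the term k = 0, which does not
  decay in u.\<close>

lemma H2_deriv_energy:
  assumes "f \<in> H2" "n \<ge> 1"
  shows "(\<integral>\<^sup>+u. indicator {0<..} u * ennreal (u ^ (2*n-1)) *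
        ennreal (circle_mean2 ((deriv ^^ n) f) (exp (-u)) - (cmod ((deriv ^^ n) f 0))\<^sup>2) \<partial>lborel)
     \<le> ennreal (fact (2*n-1) * (n+1) ^ (2*n) * H2_norm2 f)"
proof -
  define g where "g = (deriv ^^ n) f"
  define m where "m = 2 * n - 1"
  have m: "Suc m = 2 * n" using assms by (simp add: m_def)
  have hol: "g holomorphic_on ball 0 1"
    using assms unfolding g_def H2_def by (intro holomorphic_higher_deriv) auto
  let ?b = "\<lambda>k. (cmod (taylor_coeff g (Suc k)))\<^sup>2"
  have eq: "indicator {0<..} u * ennreal (u ^ m) * ennreal (circle_mean2 g (exp (-u)) - (cmod (g 0))\<^sup>2)
     = (\<Sum>k. ennreal (?b k) * (ennreal (u ^ m * exp (- (2 * real (Suc k)) * u)) * indicator {0<..} u))" for u :: real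
  proof (cases "u > 0")
    case True
    have "(\<lambda>k. (cmod (taylor_coeff g k))\<^sup>2 * exp (-u) ^ (2 * k)) sums circle_mean2 g (exp (-u))"
      by (rule Parseval[OF hol]) (use True in auto)
    hence "(\<lambda>k. ?b k * exp (-u) ^ (2 * Suc k)) sums (circle_mean2 g (exp (-u)) - (cmod (g 0))\<^sup>2)"
      using sums_Suc_iff[of "\<lambda>k. (cmod (taylor_coeff g k))\<^sup>2 * exp (-u) ^ (2 * k)" "circle_mean2 g (exp (-u)) - (cmod (g 0))\<^sup>2"]
      by (simp add: taylor_coeff_def)
    hence "(\<Sum>k. ennreal (?b k * exp (-u) ^ (2 * Suc k))) = ennreal (circle_mean2 g (exp (-u)) - (cmod (g 0))\<^sup>2)"
      by (intro suminf_ennreal_eq) auto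
    moreover have "exp (-u) ^ (2 * Suc k) = exp (- (2 * real (Suc k)) * u)" for k
      by (simp add: exp_of_nat_mult[symmetric] algebra_simps del: power_Suc)
    ultimately have "ennreal (u ^ m) * ennreal (circle_mean2 g (exp (-u)) - (cmod (g 0))\<^sup>2)
      = ennreal (u ^ m) * (\<Sum>k. ennreal (?b k * exp (- (2 * real (Suc k)) * u)))" by simp
    also have "\<dots> = (\<Sum>k. ennreal (u ^ m) * ennreal (?b k * exp (- (2 * real (Suc k)) * u)))"
      by (rule ennreal_suminf_cmult[symmetric])
    also have "\<dots> = (\<Sum>k. ennreal (?b k) * (ennreal (u ^ m * exp (- (2 * real (Suc k)) * u)) * indicator {0<..} u))"
      using True by (intro suminf_cong) (simp add: ennreal_mult'[symmetric] mult_ac)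
    finally show ?thesis using True by simp
  qed auto
  have "(\<integral>\<^sup>+u. indicator {0<..} u * ennreal (u ^ m) * ennreal (circle_mean2 g (exp (-u)) - (cmod (g 0))\<^sup>2) \<partial>lborel)
      = (\<Sum>k. \<integral>\<^sup>+u. ennreal (?b k) * (ennreal (u ^ m * exp (- (2 * real (Suc k)) * u)) * indicator {0<..} u) \<partial>lborel)"
    unfolding eq by (rule nn_integral_suminf) measurable
  also have "\<dots> \<le> (\<Sum>k. ennreal (fact m * (n+1) ^ (2*n) * (cmod (taylor_coeff f (k + Suc n)))\<^sup>2))"
  proof (intro suminf_le summableI)
    fix k
    have "(\<integral>\<^sup>+u. ennreal (?b k) * (ennreal (u ^ m * exp (- (2 * real (Suc k)) * u)) * indicator {0<..} u) \<partial>lborel)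
        = ennreal (?b k) * (\<integral>\<^sup>+u. (ennreal (u ^ m * exp (- (2 * real (Suc k)) * u)) * indicator {0<..} u) \<partial>lborel)"
      by (rule nn_integral_cmult) measurable
    also have "\<dots> \<le> ennreal (?b k) * (\<integral>\<^sup>+u. (ennreal (u ^ m * exp (- (2 * real (Suc k)) * u)) * indicator {0..} u) \<partial>lborel)"
      by (intro mult_left_mono nn_integral_mono) (auto simp: indicator_def)
    also have "\<dots> = ennreal (?b k * (fact m / (2 * real (Suc k)) ^ (2*n)))"
      by (subst nn_integral_power_exp) (simp_all add: m ennreal_mult[symmetric] del: times_divide_eq_right of_nat_Suc)
    also have "\<dots> \<le> ennreal (fact m * (n+1) ^ (2*n) * (cmod (taylor_coeff f (k + Suc n)))\<^sup>2)"
    proof (rule ennreal_leI)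
      \<comment> \<open>The quotient (k+1+n)! / (k+1)! has n factors, each at most k+1+n <=
        (k+1)(n+1).\<close>
      have "fact (Suc k + n) div fact (Suc k + n - n) \<le> (Suc k + n) ^ n"
        by (rule fact_div_fact_le_pow) simp
      hence "(fact (Suc k + n) :: nat) \<le> (Suc k + n) ^ n * fact (Suc k)"
        using fact_dvd[of "Suc k" "Suc k + n", where 'a = nat]
        by (metis add_diff_cancel_right' dvd_div_mult_self le_add1 mult_le_mono1)
      also have "(Suc k + n) ^ n \<le> (Suc k * (n + 1)) ^ n" by (intro power_mono) auto
      finally have "(fact (Suc k + n) :: nat) \<le> (Suc k * (n + 1)) ^ n * fact (Suc k)" by simp
      hence "real (fact (Suc k + n)) \<le> real ((Suc k * (n + 1)) ^ n * fact (Suc k))" by (rule of_nat_mono)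
      hence q: "fact (Suc k + n) / fact (Suc k) \<le> real ((Suc k * (n + 1)) ^ n)"
        by (simp add: pos_divide_le_eq del: fact_Suc of_nat_Suc)
      have "?b k = (cmod (taylor_coeff f (k + Suc n)))\<^sup>2 * (fact (Suc k + n) / fact (Suc k))\<^sup>2"
        unfolding g_def taylor_coeff_deriv by (simp add: norm_mult norm_divide power_mult_distrib power_divide del: fact_Suc)
      also have "\<dots> \<le> (cmod (taylor_coeff f (k + Suc n)))\<^sup>2 * (real ((Suc k * (n + 1)) ^ n))\<^sup>2"
        using q by (intro mult_left_mono power_mono) auto
      also have "\<dots> = (cmod (taylor_coeff f (k + Suc n)))\<^sup>2 * (n+1) ^ (2*n) * real (Suc k) ^ (2*n)"
        unfolding of_nat_power of_nat_mult power_mult_distrib power_even_eq by (simp add: mult_ac)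
      also have "\<dots> \<le> (cmod (taylor_coeff f (k + Suc n)))\<^sup>2 * (n+1) ^ (2*n) * (2 * real (Suc k)) ^ (2*n)"
        by (intro mult_left_mono power_mono) auto
      finally have "?b k \<le> (cmod (taylor_coeff f (k + Suc n)))\<^sup>2 * (n+1) ^ (2*n) * (2 * real (Suc k)) ^ (2*n)" .
      hence "?b k / (2 * real (Suc k)) ^ (2*n) \<le> (cmod (taylor_coeff f (k + Suc n)))\<^sup>2 * (n+1) ^ (2*n)"
        by (simp add: pos_divide_le_eq del: of_nat_Suc)
      hence "fact m * (?b k / (2 * real (Suc k)) ^ (2*n)) \<le> fact m * ((cmod (taylor_coeff f (k + Suc n)))\<^sup>2 * (n+1) ^ (2*n))"
        by (intro mult_left_mono) auto
      thus "?b k * (fact m / (2 * real (Suc k)) ^ (2*n)) \<le> fact m * (n+1) ^ (2*n) * (cmod (taylor_coeff f (k + Suc n)))\<^sup>2"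
        by (simp add: mult_ac)
    qed
    finally show "(\<integral>\<^sup>+u. ennreal (?b k) * (ennreal (u ^ m * exp (- (2 * real (Suc k)) * u)) * indicator {0<..} u) \<partial>lborel)
       \<le> ennreal (fact m * (n+1) ^ (2*n) * (cmod (taylor_coeff f (k + Suc n)))\<^sup>2)" .
  qed
  also have "\<dots> = ennreal (\<Sum>k. fact m * (n+1) ^ (2*n) * (cmod (taylor_coeff f (k + Suc n)))\<^sup>2)"
    using H2_coeffs(1)[OF assms(1)]
    by (intro suminf_ennreal2 summable_mult summable_ignore_initial_segment) auto
  also have "\<dots> \<le> ennreal (fact m * (n+1) ^ (2*n) * H2_norm2 f)"
  proof (rule ennreal_leI)
    have s: "summable (\<lambda>k. (cmod (taylor_coeff f (k + Suc n)))\<^sup>2)"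
      using H2_coeffs(1)[OF assms(1)] by (rule summable_ignore_initial_segment)
    have "(\<Sum>k. (cmod (taylor_coeff f (k + Suc n)))\<^sup>2) \<le> (\<Sum>k. (cmod (taylor_coeff f k))\<^sup>2)"
      using suminf_split_initial_segment[OF H2_coeffs(1)[OF assms(1)], of "Suc n"]
        sum_nonneg[of "{..<Suc n}" "\<lambda>k. (cmod (taylor_coeff f k))\<^sup>2"] by simp
    also have "\<dots> \<le> H2_norm2 f" by (rule H2_coeffs(2)[OF assms(1)])
    finally show "(\<Sum>k. fact m * (n+1) ^ (2*n) * (cmod (taylor_coeff f (k + Suc n)))\<^sup>2) \<le> fact m * (n+1) ^ (2*n) * H2_norm2 f"
      by (subst suminf_mult[OF s]) (intro mult_left_mono, auto)
  qed
  finally show ?thesis unfolding g_def m_def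
    by (simp only: of_nat_mult of_nat_power of_nat_add of_nat_fact of_nat_1)
qed

section \<open>Necessity\<close>

text \<open>Jensen's formula read as an upper bound for zeros. The majorant has to hold at zeros on
  the circle as well, where \<open>ln 0 = 0\<close>.\<close>

lemma zero_count_le:
  assumes "f holomorphic_on ball 0 R" "f 0 \<noteq> 0" "0 < r" "r < R"
    and "\<And>t. ln (cmod (f (complex_of_real r * cis t))) \<le> U t" "has_bochner_integral circ U I"
  shows "zero_count f r \<le> I - ln (cmod (f 0))"
  using Jensen(1)[OF assms(1-4)] assms(5,6)
    integral_mono[of circ "\<lambda>t. ln (cmod (f (complex_of_real r * cis t)))" U]
  by (auto simp: has_bochner_integral_iff)

text \<open>Allows \<phi> - w to be replaced by a function with the same zeros whose logarithm has a
  better majorant.\<close>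

lemma zero_count_times_nonvanishing:
  assumes "f holomorphic_on ball 0 R" "u holomorphic_on ball 0 R" "r < R" "0 < R" "f 0 \<noteq> 0"
    and nz: "\<And>z. z \<in> ball 0 R \<Longrightarrow> u z \<noteq> 0"
  shows "zero_count (\<lambda>z. f z * u z) r = zero_count f r"
  unfolding zero_count_def
proof (rule sum.cong)
  show "{z \<in> cball 0 r. f z * u z = 0} = {z \<in> cball 0 r. f z = 0}"
    using assms(3) nz by auto
  fix z assume "z \<in> {z \<in> cball 0 r. f z = 0}"
  hence z: "z \<in> ball 0 R" using assms(3) by auto
  have "zorder (\<lambda>z. f z * u z) z = zorder f z"
    by (rule zorder_times_nonvanishing[OF assms(1,2) open_ball connected_ball z nz[OF z] _ assms(5)])
       (use assms in simp)
  thus "zorder (\<lambda>z. f z * u z) z * ln (r / cmod z) = zorder f z * ln (r / cmod z)" by simp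
qed

lemma sum_zeros_le_zero_count:
  assumes "f holomorphic_on ball 0 R" "f 0 \<noteq> 0" "0 < r" "r < R" "finite X" "\<And>z. z \<in> X \<Longrightarrow> cmod z \<le> r \<and> f z = 0"
  shows "(\<Sum>z\<in>X. zorder f z * ln (r / cmod z)) \<le> zero_count f r"
  unfolding zero_count_def
proof (rule sum_mono2)
  show "finite {z \<in> cball 0 r. f z = 0}" by (rule Jensen(2)[OF assms(1-4)])
  show "X \<subseteq> {z \<in> cball 0 r. f z = 0}" using assms(6) by auto
  fix z assume z: "z \<in> {z \<in> cball 0 r. f z = 0} - X"
  have "zorder f z \<ge> 0"
    by (rule zorder_nonneg[OF assms(1) open_ball connected_ball _ _ assms(2)]) (use z assms in auto)
  moreover have "z \<noteq> 0" using z assms by auto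
  ultimately show "0 \<le> zorder f z * ln (r / cmod z)" using z by simp
qed

text \<open>The infinite sum is a supremum over finite sets X of zeros. Each X lies in a disc of
  radius r < 1, and letting r tend to 1 turns ln (r / |z|) into ln (1 / |z|).\<close>

lemma nevanlinna_le:
  assumes phi: "\<phi> holomorphic_on ball 0 1" "w \<noteq> \<phi> 0"
    and B: "\<And>r. 0 < r \<Longrightarrow> r < 1 \<Longrightarrow> zero_count (\<lambda>z. \<phi> z - w) r \<le> B"
  shows "nevanlinna \<phi> w \<le> ennreal B"
proof -
  let ?Z = "{z\<in>ball 0 1. \<phi> z = w}"
  let ?m = "\<lambda>z. zorder (\<lambda>z. \<phi> z - w) z"
  have hol: "(\<lambda>z. \<phi> z - w) holomorphic_on ball 0 1" by (intro holomorphic_intros phi)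
  have nz: "\<phi> 0 - w \<noteq> 0" using phi by simp
  have m: "?m z \<ge> 0" if "z \<in> ?Z" for z
    by (rule zorder_nonneg[OF hol open_ball connected_ball _ _ nz]) (use that in auto)
  have fin: "(\<Sum>z\<in>X. of_nat (nat (?m z)) * ennreal (ln (1 / cmod z))) \<le> ennreal B" if X: "finite X" "X \<subseteq> ?Z" for X
  proof -
    have X0: "z \<noteq> 0" "cmod z < 1" "?m z \<ge> 0" if "z \<in> X" for z using that X phi m by auto
    have "(\<Sum>z\<in>X. of_nat (nat (?m z)) * ennreal (ln (1 / cmod z))) = (\<Sum>z\<in>X. ennreal (?m z * ln (1 / cmod z)))"
    proof (rule sum.cong[OF refl])
      fix z assume z: "z \<in> X"
      have "of_nat (nat (?m z)) = ennreal (?m z)" using X0(3)[OF z] by (simp add: ennreal_of_nat_eq_real_of_nat)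
      thus "of_nat (nat (?m z)) * ennreal (ln (1 / cmod z)) = ennreal (?m z * ln (1 / cmod z))"
        using X0[OF z] by (simp add: ennreal_mult')
    qed
    also have "\<dots> = ennreal (\<Sum>z\<in>X. ?m z * ln (1 / cmod z))"
      using X0 by (intro sum_ennreal mult_nonneg_nonneg) (simp_all add: less_imp_le)
    also have "\<dots> \<le> ennreal B"
    proof (rule ennreal_leI, rule tendsto_upperbound)
      show "((\<lambda>r. \<Sum>z\<in>X. ?m z * ln (r / cmod z)) \<longlongrightarrow> (\<Sum>z\<in>X. ?m z * ln (1 / cmod z))) (at_left 1)"
        using X0 by (intro tendsto_intros) auto
      \<comment> \<open>Inserting 0 covers the empty set and forces r > 0.\<close>
      have "Max (insert 0 (cmod ` X)) < 1" using X X0 by (subst Max_less_iff) auto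
      hence "eventually (\<lambda>r. r \<in> {Max (insert 0 (cmod ` X))<..<1}) (at_left (1::real))"
        by (intro eventually_at_leftI[of "Max (insert 0 (cmod ` X))"]) auto
      thus "eventually (\<lambda>r. (\<Sum>z\<in>X. ?m z * ln (r / cmod z)) \<le> B) (at_left (1::real))"
      proof eventually_elim
        case (elim r)
        hence r: "0 < r" "r < 1" "\<And>z. z \<in> X \<Longrightarrow> cmod z \<le> r" using X by auto
        have "(\<Sum>z\<in>X. ?m z * ln (r / cmod z)) \<le> zero_count (\<lambda>z. \<phi> z - w) r"
          by (rule sum_zeros_le_zero_count[OF hol nz r(1,2) X(1)]) (use r X in auto)
        also have "\<dots> \<le> B" by (rule B) (use r in auto)
        finally show ?case .
      qed
    qed auto
    finally show ?thesis .
  qed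
  have "nevanlinna \<phi> w = (\<Sum>\<^sub>\<infinity>z\<in>?Z. of_nat (nat (?m z)) * ennreal (ln (1 / cmod z)))"
    using phi by (simp add: nevanlinna_def)
  also have "\<dots> \<le> ennreal B"
    by (rule infsum_le_finite_sums[OF nonneg_summable_on_complete fin]) auto
  finally show ?thesis .
qed

text \<open>The Taylor polynomial of the principal branch of $-\log \zeta$ at $1$; the term $k = 0$ vanishes
  because \<open>x / 0 = 0\<close>.\<close>
definition log_poly :: "nat \<Rightarrow> complex \<Rightarrow> complex" where
  "log_poly K \<zeta> = (\<Sum>k<Suc K. (1 - \<zeta>) ^ k / of_nat k)"

text \<open>For |1 - \<zeta>| <= 1/2 the left side is the real part of a tail of the logarithmic
  series, dominated by a geometric series of ratio 1/2. Farther away ln |\<zeta>| <= 0 and a crude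
  bound for the polynomial suffice from above; from below ln |\<zeta>| is unbounded, whence the
  restriction.\<close>

lemma log_poly_bounds:
  assumes "cmod \<zeta> \<le> 1" "\<zeta> \<noteq> 0"
  shows "ln (cmod \<zeta>) + Re (log_poly K \<zeta>) \<le> 4 ^ Suc K * cmod (1 - \<zeta>) ^ Suc K"
    and "cmod (1 - \<zeta>) \<le> 1/2 \<Longrightarrow> - (4 ^ Suc K * cmod (1 - \<zeta>) ^ Suc K) \<le> ln (cmod \<zeta>) + Re (log_poly K \<zeta>)"
proof -
  define x where "x = 1 - \<zeta>"
  have near: "\<bar>ln (cmod \<zeta>) + Re (log_poly K \<zeta>)\<bar> \<le> 4 ^ Suc K * cmod x ^ Suc K" if "cmod x \<le> 1/2"
  proof -
    let ?f = "\<lambda>n. - (x ^ n / of_nat n)"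
    have "(\<lambda>n. - ((- (- x)) ^ n) / of_nat n) sums ln (1 + - x)"
      by (rule Ln_series') (use that in simp)
    hence s: "?f sums Ln \<zeta>" by (simp add: x_def)
    have tail: "(\<lambda>n. ?f (n + Suc K)) sums (Ln \<zeta> + log_poly K \<zeta>)"
      using sums_split_initial_segment[OF s, of "Suc K"]
      by (simp add: log_poly_def x_def sum_negf algebra_simps)
    have le: "cmod (?f (n + Suc K)) \<le> cmod x ^ Suc K * (1/2) ^ n" for n
    proof -
      have "cmod (?f (n + Suc K)) = cmod x ^ Suc K * (cmod x ^ n / real (n + Suc K))"
        unfolding norm_minus_cancel norm_divide norm_power norm_of_nat power_add by (simp only: norm_mult norm_power mult_ac times_divide_eq_right times_divide_eq_left)
      also have "\<dots> \<le> cmod x ^ Suc K * (cmod x ^ n / 1)"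
        by (intro mult_left_mono divide_left_mono) auto
      also have "\<dots> \<le> cmod x ^ Suc K * (1/2) ^ n"
        using that by (auto intro!: mult_left_mono power_mono simp del: power_Suc)
      finally show ?thesis .
    qed
    have g: "(\<lambda>n. cmod x ^ Suc K * (1/2) ^ n) sums (cmod x ^ Suc K * 2)"
      using sums_mult[OF geometric_sums[of "1/2::real"], of "cmod x ^ Suc K"] by simp
    have "cmod (Ln \<zeta> + log_poly K \<zeta>) \<le> cmod x ^ Suc K * 2"
      using norm_suminf_le[of "\<lambda>n. ?f (n + Suc K)" "\<lambda>n. cmod x ^ Suc K * (1/2) ^ n"] le tail g
      by (simp add: sums_iff del: of_nat_add of_nat_Suc power_Suc)
    moreover have "\<bar>Re (Ln \<zeta> + log_poly K \<zeta>)\<bar> \<le> cmod (Ln \<zeta> + log_poly K \<zeta>)" by (rule abs_Re_le_cmod)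
    moreover have "Re (Ln \<zeta> + log_poly K \<zeta>) = ln (cmod \<zeta>) + Re (log_poly K \<zeta>)"
      using assms by simp
    moreover have "cmod x ^ Suc K * 2 \<le> 4 ^ Suc K * cmod x ^ Suc K"
    proof -
      have "(2::real) \<le> 4 * 1" by simp
      also have "\<dots> \<le> 4 * 4 ^ K" by (intro mult_left_mono) auto
      finally have "cmod x ^ Suc K * 2 \<le> cmod x ^ Suc K * 4 ^ Suc K" by (intro mult_left_mono) auto
      thus ?thesis by (simp add: mult.commute)
    qed
    ultimately show ?thesis by linarith
  qed
  have far: "ln (cmod \<zeta>) + Re (log_poly K \<zeta>) \<le> 4 ^ Suc K * cmod x ^ Suc K" if "cmod x > 1/2"
  proof -
    have x2: "cmod x \<le> 2" unfolding x_def using norm_triangle_ineq4[of 1 \<zeta>] assms by simp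
    have "Re (log_poly K \<zeta>) \<le> cmod (log_poly K \<zeta>)" by (rule complex_Re_le_cmod)
    also have "\<dots> \<le> (\<Sum>k<Suc K. 2 ^ k)"
      unfolding log_poly_def
    proof (rule sum_norm_le)
      fix k assume "k \<in> {..<Suc K}"
      show "cmod ((1 - \<zeta>) ^ k / of_nat k) \<le> 2 ^ k"
      proof (cases "k = 0")
        case False
        hence "cmod ((1 - \<zeta>) ^ k / of_nat k) \<le> cmod x ^ k / 1"
          unfolding x_def norm_divide norm_power norm_of_nat by (intro divide_left_mono) auto
        also have "\<dots> \<le> 2 ^ k" using x2 by (simp add: power_mono)
        finally show ?thesis .
      qed simp
    qed
    also have "\<dots> \<le> 2 ^ Suc K"
    proof -
      have "(\<Sum>k<m. 2 ^ k) \<le> (2::real) ^ m" for m by (induction m) auto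
      thus ?thesis .
    qed
    \<comment> \<open>Since |1 - \<zeta>| > 1/2 here, the base 4 is large enough to absorb
      2^(K+1).\<close>
    also have "\<dots> = 4 ^ Suc K * (1/2) ^ Suc K" by (simp add: power_mult_distrib[symmetric] del: power_Suc)
    also have "\<dots> \<le> 4 ^ Suc K * cmod x ^ Suc K" using that by (intro mult_left_mono power_mono) auto
    finally show ?thesis using assms by (smt (verit) ln_le_zero_iff zero_less_norm_iff)
  qed
  show "ln (cmod \<zeta>) + Re (log_poly K \<zeta>) \<le> 4 ^ Suc K * cmod (1 - \<zeta>) ^ Suc K"
    using near far unfolding x_def by linarith
  show "- (4 ^ Suc K * cmod (1 - \<zeta>) ^ Suc K) \<le> ln (cmod \<zeta>) + Re (log_poly K \<zeta>)" if "cmod (1 - \<zeta>) \<le> 1/2"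
    using near that unfolding x_def by linarith
qed

section \<open>Szego kernels as test functions\<close>

lemma one_minus_mult_nonzero:
  assumes "cmod a < 1" "cmod w \<le> 1"
  shows "1 - cnj a * w \<noteq> 0" "1 - cmod a \<le> cmod (1 - cnj a * w)"
proof -
  have "cmod a * cmod w \<le> cmod a * 1" using assms by (intro mult_left_mono) auto
  hence "cmod (cnj a * w) \<le> cmod a" by (simp add: norm_mult)
  thus "1 - cmod a \<le> cmod (1 - cnj a * w)" using norm_triangle_ineq2[of 1 "cnj a * w"] by simp
  with assms(1) show "1 - cnj a * w \<noteq> 0" by auto
qed

definition szego :: "complex \<Rightarrow> complex \<Rightarrow> complex" where
  "szego a w = 1 / (1 - cnj a * w)"

lemma higher_deriv_szego:
  assumes "cmod a < 1" "w \<in> ball 0 1"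
  shows "(deriv ^^ n) (szego a) w = fact n * cnj a ^ n / (1 - cnj a * w) ^ Suc n"
  using assms(2)
proof (induction n arbitrary: w)
  case 0
  show ?case by (simp add: szego_def)
next
  case (Suc n)
  have nz: "1 - cnj a * w \<noteq> 0" using one_minus_mult_nonzero[of a w] assms Suc.prems by auto
  have "(deriv ^^ Suc n) (szego a) w = deriv (\<lambda>w. fact n * cnj a ^ n / (1 - cnj a * w) ^ Suc n) w"
    unfolding funpow.simps o_def
    by (rule deriv_cong_ev[OF _ refl])
       (use eventually_nhds_in_open[OF open_ball Suc.prems] Suc.IH in \<open>auto elim!: eventually_mono\<close>)
  also have "\<dots> = fact (Suc n) * cnj a ^ Suc n / (1 - cnj a * w) ^ Suc (Suc n)"
  proof (rule DERIV_imp_deriv)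
    have "((\<lambda>w. fact n * cnj a ^ n * inverse ((1 - cnj a * w) ^ Suc n)) has_field_derivative
        fact n * cnj a ^ n * (- (inverse ((1 - cnj a * w) ^ Suc n) * (of_nat (Suc n) * (1 - cnj a * w) ^ n * (- cnj a)) * inverse ((1 - cnj a * w) ^ Suc n)))) (at w)"
      by (intro DERIV_cmult DERIV_inverse' derivative_eq_intros | use nz in force)+
    moreover have "fact n * cnj a ^ n * (- (inverse ((1 - cnj a * w) ^ Suc n) * (of_nat (Suc n) * (1 - cnj a * w) ^ n * (- cnj a)) * inverse ((1 - cnj a * w) ^ Suc n)))
       = fact (Suc n) * cnj a ^ Suc n / (1 - cnj a * w) ^ Suc (Suc n)"
    proof -
      have "fact n * c ^ n * (- (inverse (q ^ Suc n) * (of_nat (Suc n) * q ^ n * (- c)) * inverse (q ^ Suc n)))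
        = fact (Suc n) * c ^ Suc n / q ^ Suc (Suc n)" if "q \<noteq> 0" for q c :: complex
        using that by (simp add: field_simps)
      from this[OF nz] show ?thesis .
    qed
    ultimately show "((\<lambda>w. fact n * cnj a ^ n / (1 - cnj a * w) ^ Suc n) has_field_derivative
        fact (Suc n) * cnj a ^ Suc n / (1 - cnj a * w) ^ Suc (Suc n)) (at w)"
      by (simp only: divide_inverse)
  qed
  finally show ?case .
qed

text \<open>The Taylor coefficients are the powers of \<open>cnj a\<close>, so Parseval's series is
  geometric.\<close>

lemma szego_H2:
  assumes "cmod a < 1"
  shows "szego a \<in> H2" "H2_norm2 (szego a) \<le> 1 / (1 - (cmod a)\<^sup>2)"
proof -
  have hol: "szego a holomorphic_on ball 0 1"
    unfolding szego_def using one_minus_mult_nonzero[OF assms] by (intro holomorphic_intros) auto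
  have a2: "(cmod a)\<^sup>2 < 1" using assms by (simp add: power_less_one_iff)
  have le: "circle_mean2 (szego a) r \<le> 1 / (1 - (cmod a)\<^sup>2)" if r: "r \<in> {0<..<1}" for r
  proof -
    have c: "taylor_coeff (szego a) k = cnj a ^ k" for k
      using higher_deriv_szego[OF assms, of 0 k] by (simp add: taylor_coeff_def)
    have "(\<lambda>k. (cmod (cnj a ^ k))\<^sup>2 * r ^ (2 * k)) sums circle_mean2 (szego a) r"
      using Parseval[OF hol, of r] r by (simp add: c)
    moreover have "(cmod (cnj a ^ k))\<^sup>2 * r ^ (2 * k) = ((cmod a)\<^sup>2 * r\<^sup>2) ^ k" for k
      by (simp only: norm_power complex_mod_cnj power_mult_distrib power_mult[symmetric] mult.commute[of k 2])
    ultimately have s: "(\<lambda>k. ((cmod a)\<^sup>2 * r\<^sup>2) ^ k) sums circle_mean2 (szego a) r" by simp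
    have r2: "r\<^sup>2 \<le> 1" using r by (simp add: power_le_one)
    have le: "(cmod a)\<^sup>2 * r\<^sup>2 \<le> (cmod a)\<^sup>2" using r2 by (simp add: mult_left_le)
    have "circle_mean2 (szego a) r = 1 / (1 - (cmod a)\<^sup>2 * r\<^sup>2)"
      using sums_unique2[OF s geometric_sums] le a2 by simp
    also have "\<dots> \<le> 1 / (1 - (cmod a)\<^sup>2)" using le a2 by (intro divide_left_mono mult_pos_pos) auto
    finally show ?thesis .
  qed
  show "szego a \<in> H2" using hol le unfolding H2_def by (auto intro!: bdd_aboveI2[where M="1 / (1 - (cmod a)\<^sup>2)"])
  show "H2_norm2 (szego a) \<le> 1 / (1 - (cmod a)\<^sup>2)"
    unfolding H2_norm2_def by (rule cSUP_least) (use le in auto)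
qed

text \<open>Serves to pass from 1 - |a|^2, the natural scale of the kernel, to log (1/|a|).\<close>

lemma ln_inverse_ge:
  assumes "0 < x" "x < (1::real)"
  shows "1 - x\<^sup>2 \<le> 2 * ln (1 / x)"
proof -
  have "1 - x\<^sup>2 = (1 - x) * (1 + x)" by (simp add: power2_eq_square algebra_simps)
  also have "\<dots> \<le> (1 - x) * 2" using assms by (intro mult_left_mono) auto
  also have "\<dots> \<le> 2 * ln (1 / x)" using ln_le_minus_one[of x] assms by (simp add: ln_div)
  finally show ?thesis .
qed

text \<open>Apply Jensen's formula to $F = \zeta e^{T(\zeta)}$, where $\zeta$ is a rotation of the disc automorphism
  vanishing at $a$ evaluated at $\varphi$, and $T$ is the Taylor polynomial of $-\log$ at $1$. The factor
  $e^{T(\zeta)}$ has no zeros, but it makes $\log |F|$ of order $|1 - \zeta|^{2n+2}$, and this is dominated by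
  the squared derivative of the Szego kernel at $a$.\<close>
lemma bounded_imp_nevanlinna:
  assumes phi: "\<phi> holomorphic_on ball 0 1" "\<phi> ` ball 0 1 \<subseteq> ball 0 1"
    and bdd: "D_bounded_H2 \<phi> n"
  shows "\<exists>C r. r < 1 \<and> (\<forall>w. r < cmod w \<and> cmod w < 1 \<longrightarrow>
        nevanlinna \<phi> w \<le> ennreal (C * (ln (1 / cmod w)) ^ (2 * n + 1)))"
proof -
  obtain C where C: "\<And>f. f \<in> H2 \<Longrightarrow> D_op \<phi> n f \<in> H2 \<and> H2_norm2 (D_op \<phi> n f) \<le> C * H2_norm2 f"
    using bdd unfolding D_bounded_H2_def by blast
  \<comment> \<open>The remainder of T then has order K + 1 = 2(n + 1), the power of |1 - cnj a w|
    in the squared n-th derivative of the kernel.\<close>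
  define K where "K = 2 * n + 1"
  define d where "d = 1 - cmod (\<phi> 0)"
  have phi1: "cmod (\<phi> z) < 1" if "cmod z < 1" for z using phi(2) that by force
  have d: "0 < d" "d \<le> 1" using phi1[of 0] by (auto simp: d_def)
  \<comment> \<open>The first power comes from \<open>log_poly_bounds\<close>, the second from the
    bound |1 - \<zeta>| <= 2 X below.\<close>
  define A where "A = (4::real) ^ Suc K * 2 ^ Suc K"
  have A: "A \<ge> 0" by (simp add: A_def)
  \<comment> \<open>The two summands will bound the mean of log |F| over circles and the value -log
    |F 0|, respectively.\<close>
  define Q where "Q = A * (\<bar>C\<bar> * 4 ^ n + (1/d) ^ Suc K)"
  have Q: "Q \<ge> 0" using A d by (simp add: Q_def)
  \<comment> \<open>|a| > 1/2 keeps |a|^(2n) at or above 4^(-n). From 1 - |a| < d/8 follows \<delta>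
    <= d/4, which puts the value of \<zeta> at 0 into the range |1 - \<zeta>| <= 1/2 of the lower
    bound; it also separates a from \<phi> 0.\<close>
  define r0 where "r0 = max (1/2) (1 - d/8)"
  have "nevanlinna \<phi> a \<le> ennreal (Q * 2 ^ K * ln (1 / cmod a) ^ K)" if a: "r0 < cmod a" "cmod a < 1" for a
  proof -
    define \<delta> where "\<delta> = 1 - (cmod a)\<^sup>2"
    have a12: "1/2 < cmod a" "1 - d/8 < cmod a" using a by (auto simp: r0_def)
    have \<delta>: "0 < \<delta>" "\<delta> \<le> 1" using a by (auto simp: \<delta>_def power_less_one_iff)
    have \<delta>d: "\<delta> \<le> d / 4"
    proof -
      have "\<delta> = (1 - cmod a) * (1 + cmod a)" by (simp add: \<delta>_def power2_eq_square algebra_simps)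
      also have "\<dots> \<le> (d/8) * 2" using a a12 d by (intro mult_mono) auto
      finally show ?thesis by simp
    qed
    have a0: "a \<noteq> \<phi> 0" using a12 d by (auto simp: d_def field_simps)
    \<comment> \<open>This rotation gives 1 - |a| \<zeta> = \<delta> / (1 - cnj a \<phi>), so
      \<zeta> is near 1 wherever |1 - cnj a \<phi>| is large compared with \<delta>.\<close>
    define \<eta> where "\<eta> = cnj (sgn a)"
    have \<eta>: "cmod \<eta> = 1" "\<eta> * a = cmod a" "\<eta> \<noteq> 0" "\<eta> * cmod a = cnj a"
    proof -
      have "a \<noteq> 0" using a12 by auto
      thus "cmod \<eta> = 1" by (simp add: \<eta>_def norm_sgn)
      thus "\<eta> \<noteq> 0" by auto
      show "\<eta> * cmod a = cnj a" using \<open>a \<noteq> 0\<close> by (simp add: \<eta>_def sgn_eq)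
      show "\<eta> * a = cmod a" using \<open>a \<noteq> 0\<close>
        by (simp add: \<eta>_def sgn_eq field_simps mult.commute[of _ a] complex_norm_square[symmetric] power2_eq_square)
    qed
    define \<zeta> where "\<zeta> = (\<lambda>z. \<eta> * (a - \<phi> z) / (1 - cnj a * \<phi> z))"
    define X where "X = (\<lambda>z. \<delta> / cmod (1 - cnj a * \<phi> z))"
    have den: "1 - cnj a * \<phi> z \<noteq> 0" if "cmod z < 1" for z
      using one_minus_mult_nonzero[of a "\<phi> z"] a phi1[OF that] by auto
    have \<zeta>X: "cmod (1 - \<zeta> z) \<le> 2 * X z" "cmod (\<zeta> z) \<le> 1" if z: "cmod z < 1" for z
    proof -
      note dn = den[OF z]
      have "cmod (\<zeta> z) = cmod (Moebius_function 0 a (\<phi> z))"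
        using \<eta> by (simp add: \<zeta>_def Moebius_function_simple norm_divide norm_mult norm_minus_commute)
      thus z1: "cmod (\<zeta> z) \<le> 1"
        using Moebius_function_norm_lt_1[of a "\<phi> z" 0] a phi1[OF z] by simp
      have "1 - cmod a * \<zeta> z = (1 - cnj a * \<phi> z - (\<eta> * cmod a) * (a - \<phi> z)) / (1 - cnj a * \<phi> z)"
        using dn by (simp add: \<zeta>_def field_simps)
      also have "\<dots> = \<delta> / (1 - cnj a * \<phi> z)"
        unfolding \<eta>(4) by (simp add: \<delta>_def algebra_simps complex_norm_square[symmetric] flip: complex_norm_square)
      finally have e: "cmod (1 - cmod a * \<zeta> z) = X z" using \<delta> by (simp add: X_def norm_divide)
      \<comment> \<open>The number 1 - |a| is itself at most the modulus of 1 - |a| \<zeta>, so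
        passing from |a| \<zeta> to \<zeta> only doubles the bound.\<close>
      have "1 - \<zeta> z = (1 - cmod a * \<zeta> z) - (1 - cmod a) * \<zeta> z" by (simp add: algebra_simps)
      hence "cmod (1 - \<zeta> z) \<le> cmod (1 - cmod a * \<zeta> z) + cmod ((1 - cmod a) * \<zeta> z)"
        using norm_triangle_ineq4 by metis
      also have "cmod ((1 - cmod a) * \<zeta> z) \<le> (1 - cmod a) * 1"
        unfolding norm_mult norm_of_real using z1 a by (intro mult_mono) auto
      also have "1 - cmod a \<le> cmod (1 - cmod a * \<zeta> z)"
        using one_minus_mult_nonzero(2)[of "of_real (cmod a)" "\<zeta> z"] a z1 by simp
      finally show "cmod (1 - \<zeta> z) \<le> 2 * X z" using e by simp
    qed
    \<comment> \<open>The zero-free cofactor, chosen so that (\<phi> - a) u = \<zeta>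
      exp(T(\<zeta>)).\<close>
    define u where "u = (\<lambda>z. - \<eta> / (1 - cnj a * \<phi> z) * exp (log_poly K (\<zeta> z)))"
    have \<zeta>hol: "\<zeta> holomorphic_on ball 0 1" unfolding \<zeta>_def using den by (intro holomorphic_intros phi) auto
    have uhol: "u holomorphic_on ball 0 1"
      unfolding u_def log_poly_def using den by (intro holomorphic_intros phi \<zeta>hol) auto
    have uz: "u z \<noteq> 0" if "z \<in> ball 0 1" for z using den[of z] that \<eta> by (simp add: u_def)
    have fhol: "(\<lambda>z. \<phi> z - a) holomorphic_on ball 0 1" by (intro holomorphic_intros phi)
    define F where "F = (\<lambda>z. (\<phi> z - a) * u z)"
    have Fhol: "F holomorphic_on ball 0 1" unfolding F_def by (intro holomorphic_intros fhol uhol)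
    have F0: "F 0 \<noteq> 0" using a0 uz[of 0] by (simp add: F_def)
    have Feq: "F z = \<zeta> z * exp (log_poly K (\<zeta> z))" for z
      by (simp add: F_def u_def \<zeta>_def divide_inverse algebra_simps)
    have lnF: "ln (cmod (F z)) = ln (cmod (\<zeta> z)) + Re (log_poly K (\<zeta> z))" if "\<zeta> z \<noteq> 0" for z
      unfolding Feq using that by (simp add: norm_mult ln_mult)
    have X0: "X z \<ge> 0" for z using \<delta> by (simp add: X_def)
    have AX: "4 ^ Suc K * cmod (1 - \<zeta> z) ^ Suc K \<le> A * X z ^ Suc K" if "cmod z < 1" for z
    proof -
      have "4 ^ Suc K * cmod (1 - \<zeta> z) ^ Suc K \<le> 4 ^ Suc K * (2 * X z) ^ Suc K"
        using \<zeta>X(1)[OF that] by (intro mult_left_mono power_mono) auto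
      also have "\<dots> = A * X z ^ Suc K" unfolding A_def power_mult_distrib by (simp only: mult.assoc)
      finally show ?thesis .
    qed
    have upper: "ln (cmod (F z)) \<le> A * X z ^ Suc K" if "cmod z < 1" for z
    proof (cases "\<zeta> z = 0")
      case True
      thus ?thesis using A X0[of z] by (simp add: Feq del: power_Suc)
    next
      case False
      show ?thesis using log_poly_bounds(1)[OF \<zeta>X(2)[OF that] False, of K] AX[OF that] lnF[OF False] by linarith
    qed
    have lower: "- (Q - A * \<bar>C\<bar> * 4 ^ n) * \<delta> ^ K \<le> ln (cmod (F 0))"
    proof -
      have d1: "d \<le> cmod (1 - cnj a * \<phi> 0)"
      proof -
        have "cmod (1 - cnj a * \<phi> 0) = cmod (1 - cnj (\<phi> 0) * a)"
          by (subst complex_mod_cnj[symmetric]) (simp add: mult.commute)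
        thus ?thesis using one_minus_mult_nonzero(2)[of "\<phi> 0" a] a phi1[of 0] by (simp add: d_def)
      qed
      hence X0d: "X 0 \<le> \<delta> / d" unfolding X_def using d \<delta> den[of 0] by (intro divide_left_mono mult_pos_pos) auto
      also have "\<dots> \<le> 1/4" using \<delta>d d by (simp add: field_simps)
      finally have "cmod (1 - \<zeta> 0) \<le> 1/2" using \<zeta>X(1)[of 0] by simp
      moreover have z0: "\<zeta> 0 \<noteq> 0" using F0 by (auto simp: Feq)
      ultimately have "- (4 ^ Suc K * cmod (1 - \<zeta> 0) ^ Suc K) \<le> ln (cmod (F 0))"
        using log_poly_bounds(2)[OF \<zeta>X(2)[of 0] z0, of K] lnF[OF z0] by simp
      moreover have "4 ^ Suc K * cmod (1 - \<zeta> 0) ^ Suc K \<le> (Q - A * \<bar>C\<bar> * 4 ^ n) * \<delta> ^ K"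
      proof -
        have "4 ^ Suc K * cmod (1 - \<zeta> 0) ^ Suc K \<le> A * X 0 ^ Suc K" by (rule AX) simp
        also have "\<dots> \<le> A * (\<delta> / d) ^ Suc K" using X0d X0 A by (intro mult_left_mono power_mono) auto
        also have "\<dots> = (A * (1/d) ^ Suc K) * (\<delta> ^ K * \<delta>)" by (simp add: power_divide)
        also have "\<dots> \<le> (A * (1/d) ^ Suc K) * (\<delta> ^ K * 1)"
          using \<delta> A d by (intro mult_left_mono mult_nonneg_nonneg) auto
        also have "\<dots> = (Q - A * \<bar>C\<bar> * 4 ^ n) * \<delta> ^ K" by (simp add: Q_def algebra_simps)
        finally show ?thesis .
      qed
      ultimately show ?thesis by linarith
    qed
    have zc: "zero_count (\<lambda>z. \<phi> z - a) r \<le> Q * \<delta> ^ K" if r: "0 < r" "r < 1" for r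
    proof -
      let ?c = "\<lambda>t. complex_of_real r * cis t"
      have c1: "cmod (?c t) < 1" for t using r by (simp add: norm_mult)
      let ?D = "D_op \<phi> n (szego a)"
      have DH: "?D \<in> H2" and Dn: "H2_norm2 ?D \<le> C * H2_norm2 (szego a)"
        using C[OF szego_H2(1)] a by auto
      have "circle_mean2 ?D r \<le> C * H2_norm2 (szego a)"
        using circle_mean2_le_H2_norm2[OF DH r] Dn by linarith
      also have "\<dots> \<le> \<bar>C\<bar> * H2_norm2 (szego a)"
        using H2_norm2_nonneg[OF szego_H2(1)] a by (intro mult_right_mono) auto
      also have "\<dots> \<le> \<bar>C\<bar> * (1 / \<delta>)" unfolding \<delta>_def using szego_H2(2) a by (intro mult_left_mono) auto
      finally have Dm: "circle_mean2 ?D r \<le> \<bar>C\<bar> / \<delta>" by simp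
      have cont: "continuous_on (sphere 0 r) ?D"
        using DH r by (intro holomorphic_on_imp_continuous_on) (auto simp: H2_def intro: holomorphic_on_subset)
      \<comment> \<open>L |D|^2 will dominate log |F|: |D|^2 equals (n!)^2 |a|^(2n) |1 - cnj a
        \<phi>|^(-2n-2), and 4^n compensates |a|^(2n). The mean of |D|^2 is at most |C| / \<delta>,
        so one of the K + 1 powers of \<delta> is lost.\<close>
      define L where "L = A * 4 ^ n * \<delta> ^ Suc K"
      have "has_bochner_integral circ (\<lambda>t. L * (cmod (?D (?c t)))\<^sup>2) (L * circle_mean2 ?D r)"
        by (intro has_bochner_integral_mult_right circle_mean2_circ cont) (use r in auto)
      moreover have "ln (cmod (F (?c t))) \<le> L * (cmod (?D (?c t)))\<^sup>2" for t
      proof -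
        let ?q = "cmod (1 - cnj a * \<phi> (?c t))"
        have q: "?q > 0" using den[OF c1[of t]] by simp
        have "?D (?c t) = fact n * cnj a ^ n / (1 - cnj a * \<phi> (?c t)) ^ Suc n"
          unfolding D_op_def o_def by (rule higher_deriv_szego) (use a phi1[OF c1[of t]] in auto)
        hence D2: "(cmod (?D (?c t)))\<^sup>2 = (fact n)\<^sup>2 * (cmod a ^ n)\<^sup>2 / (?q ^ Suc n)\<^sup>2"
          by (simp add: norm_mult norm_divide norm_power power_mult_distrib power_divide del: power_Suc)
        have qe: "(?q ^ Suc n)\<^sup>2 = ?q ^ Suc K" unfolding K_def power_mult[symmetric] by (intro arg_cong2[where f=power]) auto
        have "1 \<le> 4 ^ n * ((fact n)\<^sup>2 * (cmod a ^ n)\<^sup>2)"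
        proof -
          have "1 * (1/4) ^ n \<le> (fact n)\<^sup>2 * (cmod a ^ n)\<^sup>2"
          proof (rule mult_mono)
            show "1 \<le> (fact n :: real)\<^sup>2" by (simp add: fact_ge_1)
            have "(1/4) ^ n = ((1/2) ^ n :: real)\<^sup>2" by (simp add: power2_eq_square power_mult_distrib[symmetric])
            also have "\<dots> \<le> (cmod a ^ n)\<^sup>2" using a12 by (intro power_mono) auto
            finally show "(1/4) ^ n \<le> (cmod a ^ n)\<^sup>2" .
          qed auto
          hence "4 ^ n * (1 * (1/4) ^ n) \<le> 4 ^ n * ((fact n)\<^sup>2 * (cmod a ^ n)\<^sup>2)" by (intro mult_left_mono) auto
          thus ?thesis by (simp add: power_mult_distrib[symmetric])
        qed
        hence "A * (\<delta> ^ Suc K / ?q ^ Suc K) * 1 \<le> A * (\<delta> ^ Suc K / ?q ^ Suc K) * (4 ^ n * ((fact n)\<^sup>2 * (cmod a ^ n)\<^sup>2))"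
          using A \<delta> by (intro mult_left_mono) auto
        also have "\<dots> = L * (cmod (?D (?c t)))\<^sup>2" unfolding D2 qe L_def by (simp add: field_simps del: power_Suc)
        finally show ?thesis using upper[OF c1[of t]] by (simp add: X_def power_divide del: power_Suc)
      qed
      ultimately have "zero_count F r \<le> L * circle_mean2 ?D r - ln (cmod (F 0))"
        by (intro zero_count_le[OF Fhol F0 r]) auto
      also have "L * circle_mean2 ?D r \<le> L * (\<bar>C\<bar> / \<delta>)"
        using Dm A \<delta> by (intro mult_left_mono) (auto simp: L_def)
      also have "L * (\<bar>C\<bar> / \<delta>) = A * \<bar>C\<bar> * 4 ^ n * \<delta> ^ K" using \<delta> by (simp add: L_def)
      finally have "zero_count F r \<le> Q * \<delta> ^ K" using lower by (simp add: algebra_simps)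
      moreover have "zero_count F r = zero_count (\<lambda>z. \<phi> z - a) r"
        unfolding F_def using a0 r by (intro zero_count_times_nonvanishing[OF fhol uhol _ _ _ uz]) auto
      ultimately show ?thesis by simp
    qed
    have "nevanlinna \<phi> a \<le> ennreal (Q * \<delta> ^ K)" by (rule nevanlinna_le[OF phi(1) a0 zc])
    also have "\<dots> \<le> ennreal (Q * (2 * ln (1 / cmod a)) ^ K)"
    proof (intro ennreal_leI mult_left_mono power_mono Q)
      show "\<delta> \<le> 2 * ln (1 / cmod a)" unfolding \<delta>_def by (rule ln_inverse_ge) (use a a12 in auto)
    qed (use \<delta> in auto)
    also have "Q * (2 * ln (1 / cmod a)) ^ K = Q * 2 ^ K * ln (1 / cmod a) ^ K" by (simp only: power_mult_distrib mult.assoc)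
    finally show ?thesis .
  qed
  moreover have "r0 < 1" using d by (simp add: r0_def)
  ultimately show ?thesis unfolding K_def by blast
qed

section \<open>Sufficiency\<close>

lemma sum_le_of_nevanlinna_le:
  assumes phi: "\<phi> holomorphic_on ball 0 1" "w \<noteq> \<phi> 0"
    and X: "finite X" "X \<subseteq> {z\<in>ball 0 1. \<phi> z = w}"
    and B: "nevanlinna \<phi> w \<le> ennreal B" "B \<ge> 0"
  shows "(\<Sum>z\<in>X. zorder (\<lambda>z. \<phi> z - w) z * ln (1 / cmod z)) \<le> B"
proof -
  let ?m = "\<lambda>z. zorder (\<lambda>z. \<phi> z - w) z"
  have hol: "(\<lambda>z. \<phi> z - w) holomorphic_on ball 0 1" by (intro holomorphic_intros phi)
  have nz: "\<phi> 0 - w \<noteq> 0" using phi by simp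
  have X0: "z \<noteq> 0" "cmod z < 1" "?m z \<ge> 0" if "z \<in> X" for z
  proof -
    show "z \<noteq> 0" "cmod z < 1" using that X phi by auto
    show "?m z \<ge> 0"
      by (rule zorder_nonneg[OF hol open_ball connected_ball _ _ nz]) (use that X in auto)
  qed
  have "ennreal (\<Sum>z\<in>X. ?m z * ln (1 / cmod z)) = (\<Sum>z\<in>X. ennreal (?m z * ln (1 / cmod z)))"
    using X0 by (intro sum_ennreal[symmetric] mult_nonneg_nonneg) (simp_all add: less_imp_le)
  also have "\<dots> = (\<Sum>z\<in>X. of_nat (nat (?m z)) * ennreal (ln (1 / cmod z)))"
  proof (rule sum.cong[OF refl])
    fix z assume z: "z \<in> X"
    have "of_nat (nat (?m z)) = ennreal (?m z)" using X0(3)[OF z] by (simp add: ennreal_of_nat_eq_real_of_nat)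
    thus "ennreal (?m z * ln (1 / cmod z)) = of_nat (nat (?m z)) * ennreal (ln (1 / cmod z))"
      using X0[OF z] by (simp add: ennreal_mult')
  qed
  also have "\<dots> \<le> (\<Sum>\<^sub>\<infinity>z\<in>{z\<in>ball 0 1. \<phi> z = w}. of_nat (nat (?m z)) * ennreal (ln (1 / cmod z)))"
  proof -
    let ?h = "\<lambda>z. of_nat (nat (?m z)) * ennreal (ln (1 / cmod z))"
    have "sum ?h X = infsum ?h X" by (rule infsum_finite[OF X(1), symmetric])
    also have "\<dots> \<le> infsum ?h {z\<in>ball 0 1. \<phi> z = w}"
      by (rule infsum_mono_neutral) (use X in \<open>auto intro!: nonneg_summable_on_complete\<close>)
    finally show ?thesis .
  qed
  also have "\<dots> = nevanlinna \<phi> w" using phi by (simp add: nevanlinna_def)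
  also have "\<dots> \<le> ennreal B" by (rule B)
  finally show ?thesis using B by simp
qed

text \<open>The disc automorphism vanishing at w, composed with \<phi>, has modulus below 1, so 0 is
  a majorant in \<open>zero_count_le\<close>. Its modulus at \<phi> 0 is symmetric in w and \<phi>
  0; the bound uses the automorphism attached to \<phi> 0, which can then serve as a coordinate for
  w.\<close>

lemma Littlewood:
  assumes phi: "\<phi> holomorphic_on ball 0 1" "\<phi> ` ball 0 1 \<subseteq> ball 0 1" "w \<noteq> \<phi> 0" "cmod w < 1" and r: "0 < r" "r < 1"
  shows "zero_count (\<lambda>z. \<phi> z - w) r \<le> - ln (cmod (Moebius_function 0 (\<phi> 0) w))"
proof -
  have phi1: "cmod (\<phi> z) < 1" if "cmod z < 1" for z using phi(2) that by force
  have den: "1 - cnj w * \<phi> z \<noteq> 0" if "cmod z < 1" for z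
    using one_minus_mult_nonzero[of w "\<phi> z"] phi1[OF that] phi by auto
  have hol1: "(\<lambda>z. \<phi> z - w) holomorphic_on ball 0 1" by (intro holomorphic_intros phi)
  have hol2: "(\<lambda>z. 1 / (1 - cnj w * \<phi> z)) holomorphic_on ball 0 1"
    using den by (intro holomorphic_intros phi) auto
  let ?F = "\<lambda>z. (\<phi> z - w) * (1 / (1 - cnj w * \<phi> z))"
  have Feq: "?F z = Moebius_function 0 w (\<phi> z)" for z by (simp add: Moebius_function_simple)
  have F0: "?F 0 \<noteq> 0" using phi den[of 0] by simp
  have "zero_count ?F r \<le> 0 - ln (cmod (?F 0))"
  proof (rule zero_count_le[OF holomorphic_on_mult[OF hol1 hol2] F0 r])
    fix t
    have "cmod (?F (complex_of_real r * cis t)) < 1"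
      unfolding Feq by (rule Moebius_function_norm_lt_1) (use phi r in \<open>auto intro!: phi1 simp: norm_mult\<close>)
    thus "ln (cmod (?F (complex_of_real r * cis t))) \<le> 0"
      by (cases "?F (complex_of_real r * cis t) = 0") (simp_all add: less_imp_le del: mult_eq_0_iff divide_eq_0_iff)
  qed (rule has_bochner_integral_circ_const)
  moreover have "zero_count ?F r = zero_count (\<lambda>z. \<phi> z - w) r"
    by (rule zero_count_times_nonvanishing[OF hol1 hol2]) (use phi r den in auto)
  moreover have "cmod (?F 0) = cmod (Moebius_function 0 (\<phi> 0) w)"
  proof -
    have "cmod (1 - cnj w * \<phi> 0) = cmod (1 - cnj (\<phi> 0) * w)"
      by (subst complex_mod_cnj[symmetric]) (simp add: mult.commute)
    thus ?thesis by (simp add: Moebius_function_simple norm_divide norm_minus_commute norm_mult)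
  qed
  ultimately show ?thesis by simp
qed

text \<open>The integrand is u^m (l - u)^+, as \<open>ennreal\<close> truncates at 0. The proof
  keeps only the interval from l/4 to l/2, where u^m >= (l/4)^m and l - u >= l/2; its length l/4
  completes the constant 8 * 4^m.\<close>

lemma power_le_nn_integral:
  assumes "l \<ge> 0"
  shows "ennreal (l ^ (m + 2)) \<le> ennreal (8 * 4 ^ m) * (\<integral>\<^sup>+u. indicator {0<..} u * (ennreal (u ^ m) * ennreal (l - u)) \<partial>lborel)"
proof (cases "l = 0")
  case False
  hence l: "l > 0" using assms by simp
  have "ennreal ((l/4)^m * (l/2)) * emeasure lborel {l/4..l/2} = (\<integral>\<^sup>+u. ennreal ((l/4)^m * (l/2)) * indicator {l/4..l/2} u \<partial>lborel)"
    by (rule nn_integral_cmult_indicator[symmetric]) simp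
  also have "\<dots> \<le> (\<integral>\<^sup>+u. indicator {0<..} u * (ennreal (u ^ m) * ennreal (l - u)) \<partial>lborel)"
  proof (rule nn_integral_mono)
    fix u :: real
    show "ennreal ((l/4)^m * (l/2)) * indicator {l/4..l/2} u \<le> indicator {0<..} u * (ennreal (u ^ m) * ennreal (l - u))"
    proof (cases "u \<in> {l/4..l/2}")
      case True
      hence "(l/4)^m * (l/2) \<le> u ^ m * (l - u)" using l by (intro mult_mono power_mono) auto
      thus ?thesis using True l by (auto simp: ennreal_mult[symmetric] ennreal_leI)
    qed simp
  qed
  finally have le: "ennreal ((l/4)^m * (l/2)) * ennreal (l/4) \<le> (\<integral>\<^sup>+u. indicator {0<..} u * (ennreal (u ^ m) * ennreal (l - u)) \<partial>lborel)"
    using l by (simp add: field_simps)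
  have "l ^ (m + 2) = (8 * 4 ^ m) * (((l/4)^m * (l/2)) * (l/4))"
    by (simp add: power_divide power_add power2_eq_square)
  hence "ennreal (l ^ (m + 2)) = ennreal (8 * 4 ^ m) * (ennreal ((l/4)^m * (l/2)) * ennreal (l/4))"
    using l by (simp only: ennreal_mult[symmetric] zero_le_mult_iff zero_le_power zero_le_divide_iff less_imp_le[OF l])
       (simp add: ennreal_mult[symmetric] less_imp_le[OF l])
  also have "\<dots> \<le> ennreal (8 * 4 ^ m) * (\<integral>\<^sup>+u. indicator {0<..} u * (ennreal (u ^ m) * ennreal (l - u)) \<partial>lborel)"
    by (intro mult_left_mono le) auto
  finally show ?thesis .
qed simp

text \<open>The points \<open>w0\<close> and \<open>x\<close> witness that g - \<alpha> does not
  vanish identically and that p is not constant, so both factors are orders of isolated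
  zeros.\<close>

lemma zorder_compose_holomorphic:
  assumes g: "g holomorphic_on ball 0 1" "g w0 \<noteq> \<alpha>" "w0 \<in> ball 0 1"
    and p: "p holomorphic_on ball 0 1" "p ` ball 0 1 \<subseteq> ball 0 1" "x \<in> ball 0 1" "p x \<noteq> p z" "z \<in> ball 0 1"
  shows "zorder (\<lambda>x. g (p x) - \<alpha>) z = zorder (\<lambda>w. g w - \<alpha>) (p z) * zorder (\<lambda>x. p x - p z) z"
proof -
  have hol: "(\<lambda>w. g w - \<alpha>) holomorphic_on ball 0 1" by (intro holomorphic_intros g)
  have pz: "p z \<in> ball 0 1" using p by blast
  hence an: "(\<lambda>w. g w - \<alpha>) analytic_on {p z}" using hol analytic_at open_ball by blast
  have "zorder ((\<lambda>w. g w - \<alpha>) \<circ> p) z = zorder (\<lambda>w. g w - \<alpha>) (p z) * zorder (\<lambda>x. p x - p z) z"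
  proof (rule zorder_compose')
    show "isolated_singularity_at (\<lambda>w. g w - \<alpha>) (p z)" "not_essential (\<lambda>w. g w - \<alpha>) (p z)"
      using an isolated_singularity_at_analytic not_essential_analytic by auto
    show "p analytic_on {z}" using p analytic_at open_ball by blast
    show "eventually (\<lambda>w. g w - \<alpha> \<noteq> 0) (at (p z))"
      by (rule eventually_nonzero_at[OF hol open_ball connected_ball pz g(3)]) (use g in simp)
    have "eventually (\<lambda>y. p y - p z \<noteq> 0) (at z)"
      by (rule eventually_nonzero_at[OF _ open_ball connected_ball p(5) p(3)]) (use p in \<open>auto intro!: holomorphic_intros\<close>)
    thus "eventually (\<lambda>y. p y \<noteq> p z) (at z)" by simp
  qed
  thus ?thesis by (simp add: o_def)
qed

text \<open>Fubini asks for joint measurability in \<alpha> and u. As u ranges over all reals, the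
  radius e^(-u) leaves the unit disc, which is why f is taken Borel on the whole plane.\<close>

lemma measurable_jensen_radius:
  assumes [measurable]: "f \<in> borel_measurable borel"
  shows "(\<lambda>(q, u). jensen f (exp (- u)) q) \<in> borel_measurable (polar \<Otimes>\<^sub>M (lborel :: real measure))"
  unfolding jensen_def by measurable

lemma circle_mean2_le:
  assumes "continuous_on (sphere 0 r) f" "0 \<le> r" "\<And>z. cmod z = r \<Longrightarrow> (cmod (f z))\<^sup>2 \<le> M"
  shows "circle_mean2 f r \<le> M"
proof -
  have "(\<integral>t. (cmod (f (complex_of_real r * cis t)))\<^sup>2 \<partial>circ) \<le> (\<integral>t. M \<partial>circ)"
    using circle_mean2_circ[OF assms(1,2)] assms(2,3)
    by (intro integral_mono) (auto simp: has_bochner_integral_iff norm_mult)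
  moreover have "(\<integral>t. M \<partial>circ) = M"
    by (rule has_bochner_integral_integral_eq[OF has_bochner_integral_circ_const])
  ultimately show ?thesis using circle_mean2_circ[OF assms(1,2)]
    by (simp only: has_bochner_integral_iff)
qed

text \<open>Zeros of $g \circ \varphi - \alpha$ are grouped by $w = \varphi(z)$. For $|w| > \rho$ the hypothesis on the
  counting function is used, and $(\log 1/|w|)^{m+2}$ is written as a superposition of the functions
  $\log^+ (e^{-u}/|w|)$ that occur in the zero counts of $g - \alpha$ on smaller discs. For $|w| \le \rho$
  Littlewood's inequality reduces to a zero count of $g$ composed with a disc automorphism.\<close>
lemma zero_count_compose_le:
  assumes phi: "\<phi> holomorphic_on ball 0 1" "\<phi> ` ball 0 1 \<subseteq> ball 0 1"
    and g: "g holomorphic_on ball 0 1" "g (\<phi> 0) \<noteq> \<alpha>" "g 0 \<noteq> \<alpha>" and r: "0 < r" "r < 1"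
    and \<rho>: "0 \<le> \<rho>" "\<rho> < 1" and C: "C \<ge> 0"
    and N: "\<And>w. \<rho> < cmod w \<Longrightarrow> cmod w < 1 \<Longrightarrow> nevanlinna \<phi> w \<le> ennreal (C * ln (1 / cmod w) ^ (m + 2))"
    and R: "0 < R" "R < 1" "\<And>w. cmod w \<le> \<rho> \<Longrightarrow> cmod (Moebius_function 0 (\<phi> 0) w) \<le> R\<^sup>2"
  shows "ennreal (zero_count (\<lambda>z. g (\<phi> z) - \<alpha>) r)
    \<le> ennreal (C * (8 * 4 ^ m)) * (\<integral>\<^sup>+u. indicator {0<..} u * (ennreal (u ^ m) * ennreal (zero_count (\<lambda>w. g w - \<alpha>) (exp (- u)))) \<partial>lborel)
      + ennreal (2 * zero_count (\<lambda>v. g (Moebius_function 0 (- \<phi> 0) v) - \<alpha>) R)"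
proof -
  let ?\<psi> = "Moebius_function 0 (\<phi> 0)" and ?\<sigma> = "Moebius_function 0 (- \<phi> 0)"
  have phi1: "cmod (\<phi> z) < 1" if "cmod z < 1" for z using phi(2) that by force
  define Z where "Z = {z\<in>cball 0 r. g (\<phi> z) - \<alpha> = 0}"
  have Ghol: "(\<lambda>z. g (\<phi> z) - \<alpha>) holomorphic_on ball 0 1"
    using holomorphic_on_compose_gen[OF phi(1) g(1) phi(2)] by (intro holomorphic_intros) (simp add: o_def)
  have fin: "finite Z" unfolding Z_def by (rule Jensen(2)[OF Ghol _ r]) (use g in simp)
  have ghol: "(\<lambda>w. g w - \<alpha>) holomorphic_on ball 0 1" by (intro holomorphic_intros g)
  have g0: "g 0 - \<alpha> \<noteq> 0" using g by simp
  define W where "W = \<phi> ` Z"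
  have fib: "finite {z\<in>Z. \<phi> z = w}" "{z\<in>Z. \<phi> z = w} \<subseteq> {z\<in>ball 0 1. \<phi> z = w}" for w
    using fin r by (simp, auto simp: Z_def)
  have finW: "finite W" using fin by (simp add: W_def)
  have W: "cmod w < 1" "g w = \<alpha>" "w \<noteq> 0" "w \<noteq> \<phi> 0" if "w \<in> W" for w
    using that g r phi1 by (auto simp: W_def Z_def)
  define M where "M = (\<lambda>w. real_of_int (zorder (\<lambda>w. g w - \<alpha>) w))"
  \<comment> \<open>Every w in W satisfies g w = \<alpha>, so the fibre of Z over w consists of all
    zeros of \<phi> - w in the closed disc. Since orders multiply under composition, the zero count
    of the composition is the sum of M w S w.\<close>
  define S where "S = (\<lambda>w. \<Sum>z\<in>{z\<in>Z. \<phi> z = w}. zorder (\<lambda>z. \<phi> z - w) z * ln (r / cmod z))"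
  have M0: "M w \<ge> 0" if "w \<in> W" for w
    unfolding M_def using zorder_nonneg(1)[OF ghol open_ball connected_ball _ _ g0, of w] W[OF that] by simp
  have "zero_count (\<lambda>z. g (\<phi> z) - \<alpha>) r = (\<Sum>z\<in>Z. M (\<phi> z) * (zorder (\<lambda>x. \<phi> x - \<phi> z) z * ln (r / cmod z)))"
    unfolding zero_count_def Z_def[symmetric]
  proof (rule sum.cong[OF refl])
    fix z assume z: "z \<in> Z"
    have "zorder (\<lambda>x. g (\<phi> x) - \<alpha>) z = zorder (\<lambda>w. g w - \<alpha>) (\<phi> z) * zorder (\<lambda>x. \<phi> x - \<phi> z) z"
      by (rule zorder_compose_holomorphic[OF g(1) g(3) _ phi, of 0]) (use z r g in \<open>auto simp: Z_def\<close>)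
    thus "zorder (\<lambda>x. g (\<phi> x) - \<alpha>) z * ln (r / cmod z) = M (\<phi> z) * (zorder (\<lambda>x. \<phi> x - \<phi> z) z * ln (r / cmod z))"
      by (simp add: M_def)
  qed
  also have "\<dots> = (\<Sum>w\<in>W. \<Sum>z\<in>{z\<in>Z. \<phi> z = w}. M (\<phi> z) * (zorder (\<lambda>x. \<phi> x - \<phi> z) z * ln (r / cmod z)))"
    unfolding W_def by (rule sum.image_gen[OF fin])
  also have "\<dots> = (\<Sum>w\<in>W. M w * S w)"
    unfolding S_def sum_distrib_left by (intro sum.cong refl) auto
  finally have zc: "zero_count (\<lambda>z. g (\<phi> z) - \<alpha>) r = (\<Sum>w\<in>W. M w * S w)" .
  define W1 where "W1 = {w\<in>W. \<rho> < cmod w}"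
  define W2 where "W2 = {w\<in>W. cmod w \<le> \<rho>}"
  have split: "(\<Sum>w\<in>W. M w * S w) = (\<Sum>w\<in>W1. M w * S w) + (\<Sum>w\<in>W2. M w * S w)"
    using finW by (subst sum.union_disjoint[symmetric]) (auto simp: W1_def W2_def intro!: sum.cong)
  have ln0: "ln (1 / cmod w) \<ge> 0" if "w \<in> W" for w using W[OF that] by simp
  have S1: "S w \<le> C * ln (1 / cmod w) ^ (m + 2)" if "w \<in> W1" for w
  proof -
    have w: "w \<in> W" "\<rho> < cmod w" using that by (auto simp: W1_def)
    have "S w \<le> (\<Sum>z\<in>{z\<in>Z. \<phi> z = w}. zorder (\<lambda>z. \<phi> z - w) z * ln (1 / cmod z))"
      unfolding S_def
    proof (rule sum_mono)
      fix z assume z: "z \<in> {z\<in>Z. \<phi> z = w}"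
      have "zorder (\<lambda>z. \<phi> z - w) z \<ge> 0"
        by (rule zorder_nonneg(1)[where S = "ball 0 1" and w = 0])
           (use z r W(4)[OF w(1)] phi in \<open>auto simp: Z_def intro!: holomorphic_intros\<close>)
      moreover have "z \<noteq> 0" using z W(4)[OF w(1)] by auto
      ultimately show "zorder (\<lambda>z. \<phi> z - w) z * ln (r / cmod z) \<le> zorder (\<lambda>z. \<phi> z - w) z * ln (1 / cmod z)"
        using r by (intro mult_left_mono) (auto simp: ln_div)
    qed
    also have "\<dots> \<le> C * ln (1 / cmod w) ^ (m + 2)"
      by (rule sum_le_of_nevanlinna_le[OF phi(1) W(4)[OF w(1)] fib N[OF w(2) W(1)[OF w(1)]]])
         (intro mult_nonneg_nonneg zero_le_power C ln0[OF w(1)])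
    finally show ?thesis .
  qed
  have "(\<Sum>w\<in>W1. M w * S w) \<le> C * (\<Sum>w\<in>W1. M w * ln (1 / cmod w) ^ (m + 2))"
    unfolding sum_distrib_left
  proof (rule sum_mono)
    fix w assume w: "w \<in> W1"
    hence "M w * S w \<le> M w * (C * ln (1 / cmod w) ^ (m + 2))"
      using M0[of w] S1[OF w] by (intro mult_left_mono) (auto simp: W1_def)
    thus "M w * S w \<le> C * (M w * ln (1 / cmod w) ^ (m + 2))" by (simp add: mult_ac)
  qed
  hence "ennreal (\<Sum>w\<in>W1. M w * S w) \<le> ennreal (C * (\<Sum>w\<in>W1. M w * ln (1 / cmod w) ^ (m + 2)))"
    by (rule ennreal_leI)
  also have "\<dots> = ennreal C * (\<Sum>w\<in>W1. ennreal (M w) * ennreal (ln (1 / cmod w) ^ (m + 2)))"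
  proof -
    have "(\<Sum>w\<in>W1. ennreal (M w) * ennreal (ln (1 / cmod w) ^ (m + 2))) = (\<Sum>w\<in>W1. ennreal (M w * ln (1 / cmod w) ^ (m + 2)))"
      using M0 ln0 by (intro sum.cong refl ennreal_mult[symmetric] zero_le_power) (auto simp: W1_def)
    also have "\<dots> = ennreal (\<Sum>w\<in>W1. M w * ln (1 / cmod w) ^ (m + 2))"
      using M0 ln0 by (intro sum_ennreal mult_nonneg_nonneg zero_le_power) (auto simp: W1_def)
    finally show ?thesis using C by (simp add: ennreal_mult')
  qed
  \<comment> \<open>The power of the logarithm is replaced by its superposition here; the sum over
    zeros then moves under the integral.\<close>
  also have "\<dots> \<le> ennreal C * (\<Sum>w\<in>W1. ennreal (M w) * (ennreal (8 * 4 ^ m) *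
      (\<integral>\<^sup>+u. indicator {0<..} u * (ennreal (u ^ m) * ennreal (ln (1 / cmod w) - u)) \<partial>lborel)))"
    by (intro mult_left_mono sum_mono power_le_nn_integral ln0) (auto simp: W1_def)
  also have "\<dots> = ennreal C * (ennreal (8 * 4 ^ m) * (\<Sum>w\<in>W1.
      (\<integral>\<^sup>+u. ennreal (M w) * (indicator {0<..} u * (ennreal (u ^ m) * ennreal (ln (1 / cmod w) - u))) \<partial>lborel)))"
    by (subst nn_integral_cmult) (simp_all add: sum_distrib_left mult_ac)
  also have "\<dots> = ennreal (C * (8 * 4 ^ m)) * (\<integral>\<^sup>+u. (\<Sum>w\<in>W1. ennreal (M w) * (indicator {0<..} u * (ennreal (u ^ m) * ennreal (ln (1 / cmod w) - u)))) \<partial>lborel)"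
    using C by (subst nn_integral_sum) (simp_all add: ennreal_mult mult.assoc)
  also have "\<dots> \<le> ennreal (C * (8 * 4 ^ m)) * (\<integral>\<^sup>+u. indicator {0<..} u * (ennreal (u ^ m) * ennreal (zero_count (\<lambda>w. g w - \<alpha>) (exp (- u)))) \<partial>lborel)"
  proof (intro mult_left_mono nn_integral_mono)
    fix u :: real
    show "(\<Sum>w\<in>W1. ennreal (M w) * (indicator {0<..} u * (ennreal (u ^ m) * ennreal (ln (1 / cmod w) - u))))
       \<le> indicator {0<..} u * (ennreal (u ^ m) * ennreal (zero_count (\<lambda>w. g w - \<alpha>) (exp (- u))))"
    proof (cases "u > 0")
      case True
      let ?s = "exp (- u)"
      let ?V = "{w\<in>W1. cmod w \<le> ?s}"
      have VW: "w \<in> W" if "w \<in> ?V" for w using that by (auto simp: W1_def)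
      have fV: "finite W1" using finW by (simp add: W1_def)
      have lnV: "ln (1 / cmod w) - u = ln (?s / cmod w)" if "w \<in> W1" for w
        using W(3)[of w] that by (simp add: ln_div W1_def)
      \<comment> \<open>By \<open>lnV\<close>, zeros w outside radius e^(-u) have ln (1/|w|) - u <=
        0 and drop out by truncation; the others are counted as on that radius.\<close>
      have "(\<Sum>w\<in>W1. ennreal (M w) * ennreal (ln (1 / cmod w) - u)) = (\<Sum>w\<in>?V. ennreal (M w) * ennreal (ln (1 / cmod w) - u))"
      proof (rule sum.mono_neutral_right[OF fV])
        show "\<forall>w\<in>W1 - ?V. ennreal (M w) * ennreal (ln (1 / cmod w) - u) = 0"
        proof
          fix w assume w: "w \<in> W1 - ?V"
          hence "cmod w > ?s" by auto
          hence "ln (?s / cmod w) \<le> 0"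
            using order.strict_trans[OF exp_gt_zero[of "-u"], of "cmod w"]
            by (subst ln_le_zero_iff) (simp_all add: divide_le_eq less_imp_le)
          hence "ln (1 / cmod w) - u \<le> 0" using lnV[of w] w by simp
          thus "ennreal (M w) * ennreal (ln (1 / cmod w) - u) = 0" by (simp add: ennreal_neg)
        qed
      qed auto
      also have "\<dots> = (\<Sum>w\<in>?V. ennreal (zorder (\<lambda>w. g w - \<alpha>) w * ln (?s / cmod w)))"
      proof (rule sum.cong[OF refl])
        fix w assume w: "w \<in> ?V"
        hence l: "ln (1 / cmod w) - u = ln (?s / cmod w)" by (intro lnV) auto
        show "ennreal (M w) * ennreal (ln (1 / cmod w) - u) = ennreal (zorder (\<lambda>w. g w - \<alpha>) w * ln (?s / cmod w))"
          unfolding l M_def using M0[OF VW[OF w]] by (simp add: M_def ennreal_mult')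
      qed
      also have "\<dots> = ennreal (\<Sum>w\<in>?V. zorder (\<lambda>w. g w - \<alpha>) w * ln (?s / cmod w))"
      proof (rule sum_ennreal)
        fix w assume w: "w \<in> ?V"
        have "ln (?s / cmod w) \<ge> 0" using w W(3)[OF VW[OF w]] by simp
        thus "0 \<le> zorder (\<lambda>w. g w - \<alpha>) w * ln (?s / cmod w)" using M0[OF VW[OF w]] by (simp add: M_def)
      qed
      also have "\<dots> \<le> ennreal (zero_count (\<lambda>w. g w - \<alpha>) ?s)"
        by (intro ennreal_leI sum_zeros_le_zero_count[OF ghol g0]) (use True fV VW W in auto)
      finally have "(\<Sum>w\<in>W1. ennreal (M w) * ennreal (ln (1 / cmod w) - u)) \<le> ennreal (zero_count (\<lambda>w. g w - \<alpha>) ?s)" .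
      hence "ennreal (u ^ m) * (\<Sum>w\<in>W1. ennreal (M w) * ennreal (ln (1 / cmod w) - u)) \<le> ennreal (u ^ m) * ennreal (zero_count (\<lambda>w. g w - \<alpha>) ?s)"
        by (rule mult_left_mono) simp
      thus ?thesis using True by (simp add: sum_distrib_left mult_ac)
    qed simp
  qed simp
  finally have outer: "ennreal (\<Sum>w\<in>W1. M w * S w) \<le> \<dots>" .

  have S2: "S w \<le> 2 * ln (R / cmod (?\<psi> w))" if "w \<in> W2" for w
  proof -
    have w: "w \<in> W" "cmod w \<le> \<rho>" using that by (auto simp: W2_def)
    have hol: "(\<lambda>z. \<phi> z - w) holomorphic_on ball 0 1" by (intro holomorphic_intros phi)
    have "S w \<le> zero_count (\<lambda>z. \<phi> z - w) r"
      unfolding S_def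
      by (rule sum_zeros_le_zero_count[OF hol _ r fib(1)]) (use W(4)[OF w(1)] in \<open>auto simp: Z_def\<close>)
    also have "\<dots> \<le> - ln (cmod (?\<psi> w))"
      by (rule Littlewood[OF phi W(4)[OF w(1)] W(1)[OF w(1)] r])
    \<comment> \<open>The bound |\<psi> w| <= R^2 means 1/|\<psi> w| <= (R/|\<psi> w|)^2: shrinking
      the radius from 1 to R costs only the factor 2. This is the purpose of the square in the
      hypothesis on R.\<close>
    also have "\<dots> \<le> 2 * ln (R / cmod (?\<psi> w))"
    proof -
      have "?\<psi> w \<noteq> 0" using W(4,1)[OF w(1)] phi1[of 0] one_minus_mult_nonzero(1)[of "\<phi> 0" w]
        by (simp add: Moebius_function_simple)
      moreover have "ln (cmod (?\<psi> w)) \<le> ln (R\<^sup>2)" using R(3)[OF w(2)] calculation by (subst ln_le_cancel_iff) (use R in auto)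
      ultimately show ?thesis using R by (simp add: ln_div ln_realpow)
    qed
    finally show ?thesis .
  qed
  have \<sigma>hol: "?\<sigma> holomorphic_on ball 0 1" by (rule Moebius_function_holomorphic) (use phi1[of 0] in simp)
  have \<sigma>im: "?\<sigma> ` ball 0 1 \<subseteq> ball 0 1"
    using Moebius_function_norm_lt_1[of "- \<phi> 0"] phi1[of 0] by auto
  have \<sigma>\<psi>: "?\<sigma> (?\<psi> w) = w" if "w \<in> W" for w
    by (rule Moebius_function_compose) (use phi1[of 0] W(1)[OF that] in auto)
  have \<psi>\<sigma>: "?\<psi> (?\<sigma> v) = v" if "cmod v < 1" for v
    by (rule Moebius_function_compose) (use phi1[of 0] that in auto)
  have \<sigma>0: "?\<sigma> 0 = \<phi> 0" by (simp add: Moebius_function_of_zero)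
  let ?h = "\<lambda>v. g (?\<sigma> v) - \<alpha>"
  have hhol: "?h holomorphic_on ball 0 1"
    using holomorphic_on_compose_gen[OF \<sigma>hol g(1) \<sigma>im] by (intro holomorphic_intros) (simp add: o_def)
  have inj: "inj_on ?\<psi> W2" by (rule inj_on_inverseI[of _ ?\<sigma>]) (use \<sigma>\<psi> in \<open>auto simp: W2_def\<close>)
  have "(\<Sum>w\<in>W2. M w * S w) \<le> (\<Sum>w\<in>W2. 2 * (zorder ?h (?\<psi> w) * ln (R / cmod (?\<psi> w))))"
  proof (rule sum_mono)
    fix w assume w2: "w \<in> W2"
    hence w: "w \<in> W" "cmod w \<le> \<rho>" by (auto simp: W2_def)
    define v where "v = ?\<psi> w"
    have v1: "cmod v < 1" unfolding v_def by (rule Moebius_function_norm_lt_1) (use phi1[of 0] W(1)[OF w(1)] in auto)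
    have vw: "?\<sigma> v = w" unfolding v_def by (rule \<sigma>\<psi>[OF w(1)])
    have ne: "?\<sigma> 0 \<noteq> ?\<sigma> v" using W(4)[OF w(1)] \<sigma>0 vw by simp
    have "zorder ?h v = zorder (\<lambda>w. g w - \<alpha>) (?\<sigma> v) * zorder (\<lambda>x. ?\<sigma> x - ?\<sigma> v) v"
      by (rule zorder_compose_holomorphic[OF g(1) g(3) _ \<sigma>hol \<sigma>im _ ne]) (use v1 in auto)
    moreover have "zorder (\<lambda>x. ?\<sigma> x - ?\<sigma> v) v > 0"
      by (rule zorder_nonneg(2)[where S = "ball 0 1" and w = 0])
         (use v1 ne in \<open>auto intro!: holomorphic_intros \<sigma>hol\<close>)
    moreover have "zorder (\<lambda>w. g w - \<alpha>) w \<ge> 0" using M0[OF w(1)] by (simp add: M_def)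
    ultimately have "zorder (\<lambda>w. g w - \<alpha>) w \<le> zorder ?h v"
      unfolding vw using mult_left_mono[of 1 "zorder (\<lambda>x. ?\<sigma> x - w) v" "zorder (\<lambda>w. g w - \<alpha>) w"] by simp
    hence Mh: "M w \<le> zorder ?h v" by (simp add: M_def)
    have vR: "cmod v \<le> R"
    proof -
      have "cmod v \<le> R\<^sup>2" unfolding v_def by (rule R(3)[OF w(2)])
      also have "\<dots> \<le> R" using R by (simp add: power2_eq_square mult_left_le)
      finally show ?thesis .
    qed
    have v0: "v \<noteq> 0" using ne by auto
    have "M w * S w \<le> M w * (2 * ln (R / cmod v))"
      using S2[OF w2] M0[OF w(1)] unfolding v_def by (rule mult_left_mono)
    also have "\<dots> \<le> zorder ?h v * (2 * ln (R / cmod v))"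
      using Mh vR v0 by (intro mult_right_mono) auto
    finally show "M w * S w \<le> 2 * (zorder ?h (?\<psi> w) * ln (R / cmod (?\<psi> w)))" by (simp add: v_def)
  qed
  also have "\<dots> = 2 * (\<Sum>v\<in>?\<psi> ` W2. zorder ?h v * ln (R / cmod v))"
    by (simp add: sum.reindex[OF inj] sum_distrib_left)
  also have "\<dots> \<le> 2 * zero_count ?h R"
  proof (intro mult_left_mono sum_zeros_le_zero_count[OF hhol _ R(1,2)])
    show "?h 0 \<noteq> 0" using g \<sigma>0 by simp
    show "finite (?\<psi> ` W2)" using finW by (simp add: W2_def)
    fix v assume "v \<in> ?\<psi> ` W2"
    then obtain w where w: "w \<in> W" "cmod w \<le> \<rho>" "v = ?\<psi> w" by (auto simp: W2_def)
    have "cmod v \<le> R\<^sup>2" unfolding w(3) by (rule R(3)[OF w(2)])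
    also have "\<dots> \<le> R" using R by (simp add: power2_eq_square mult_left_le)
    finally show "cmod v \<le> R \<and> ?h v = 0" using \<sigma>\<psi>[OF w(1)] W(2)[OF w(1)] w(3) by simp
  qed simp
  finally have inner: "(\<Sum>w\<in>W2. M w * S w) \<le> 2 * zero_count ?h R" .
  have "ennreal (zero_count (\<lambda>z. g (\<phi> z) - \<alpha>) r) \<le> ennreal (\<Sum>w\<in>W1. M w * S w) + ennreal (2 * zero_count ?h R)"
  proof -
    have c: "zero_count ?h R \<ge> 0" by (rule zero_count_nonneg[OF hhol _ R(1,2)]) (use g \<sigma>0 in simp)
    \<comment> \<open>The sum over W1 is cut off at 0, since additivity of \<open>ennreal\<close>
      asks for nonnegative summands.\<close>
    have "ennreal (zero_count (\<lambda>z. g (\<phi> z) - \<alpha>) r) \<le> ennreal (max 0 (\<Sum>w\<in>W1. M w * S w) + 2 * zero_count ?h R)"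
      unfolding zc split using inner by (intro ennreal_leI) simp
    also have "\<dots> = ennreal (max 0 (\<Sum>w\<in>W1. M w * S w)) + ennreal (2 * zero_count ?h R)"
      using c by (intro ennreal_plus) auto
    also have "ennreal (max 0 (\<Sum>w\<in>W1. M w * S w)) = ennreal (\<Sum>w\<in>W1. M w * S w)"
      by (simp add: max_def ennreal_neg)
    finally show ?thesis .
  qed
  also have "\<dots> \<le> ennreal (C * (8 * 4 ^ m)) * (\<integral>\<^sup>+u. indicator {0<..} u * (ennreal (u ^ m) * ennreal (zero_count (\<lambda>w. g w - \<alpha>) (exp (- u)))) \<partial>lborel)
      + ennreal (2 * zero_count ?h R)"
    by (intro add_right_mono outer)
  finally show ?thesis .
qed

section \<open>From zero counts to square means\<close>

lemma holomorphic_self_map_bound: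
  assumes "h holomorphic_on ball 0 1" "h ` ball 0 1 \<subseteq> ball 0 1" "0 \<le> \<rho>" "\<rho> < 1"
  obtains s where "s < 1" "\<And>w. cmod w \<le> \<rho> \<Longrightarrow> cmod (h w) \<le> s"
proof -
  have "continuous_on (cball 0 \<rho>) (\<lambda>w. cmod (h w))"
    by (intro continuous_intros holomorphic_on_imp_continuous_on holomorphic_on_subset[OF assms(1)]) (use assms in auto)
  from continuous_attains_sup[OF compact_cball _ this] assms
  obtain x where x: "x \<in> cball 0 \<rho>" "\<And>w. w \<in> cball 0 \<rho> \<Longrightarrow> cmod (h w) \<le> cmod (h x)" by auto
  show ?thesis
    by (rule that[of "cmod (h x)"]) (use x assms(2,4) in force)+
qed

text \<open>\<open>zero_count_compose_le\<close> is integrated over \<alpha>. Its main term becomes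
  the weighted energy bounded by \<open>H2_deriv_energy\<close>; its inner term becomes a square
  mean, over one fixed circle, of the n-th derivative composed with a disc automorphism, bounded by
  \<open>H2_deriv_growth\<close>.\<close>

lemma nevanlinna_imp_bounded:
  assumes phi: "\<phi> holomorphic_on ball 0 1" "\<phi> ` ball 0 1 \<subseteq> ball 0 1" and n: "n \<ge> 1"
    and r0: "r0 < 1" and N: "\<And>w. r0 < cmod w \<Longrightarrow> cmod w < 1 \<Longrightarrow>
        nevanlinna \<phi> w \<le> ennreal (C * (ln (1 / cmod w)) ^ (2 * n + 1))"
  shows "D_bounded_H2 \<phi> n"
proof -
  \<comment> \<open>The exponent of the weight. Since n >= 1 the subtraction of naturals is exact,
    and m + 2 is the exponent of the growth condition.\<close>
  define m where "m = 2 * n - 1"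
  have m: "m + 2 = 2 * n + 1" using n by (simp add: m_def)
  define \<rho> where "\<rho> = max r0 0"
  have \<rho>: "0 \<le> \<rho>" "\<rho> < 1" "r0 \<le> \<rho>" using r0 by (auto simp: \<rho>_def)
  have N': "nevanlinna \<phi> w \<le> ennreal (\<bar>C\<bar> * ln (1 / cmod w) ^ (m + 2))" if "\<rho> < cmod w" "cmod w < 1" for w
  proof -
    have "cmod w > 0" using that \<rho> by linarith
    hence "ln (1 / cmod w) \<ge> 0" using that by simp
    hence "ennreal (C * ln (1 / cmod w) ^ (2 * n + 1)) \<le> ennreal (\<bar>C\<bar> * ln (1 / cmod w) ^ (2 * n + 1))"
      by (intro ennreal_leI mult_right_mono zero_le_power) auto
    with N[of w] that \<rho> show ?thesis unfolding m by force
  qed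
  have phi1: "cmod (\<phi> z) < 1" if "cmod z < 1" for z using phi(2) that by force
  define \<sigma> where "\<sigma> = Moebius_function 0 (- \<phi> 0)"
  have \<psi>hol: "Moebius_function 0 (\<phi> 0) holomorphic_on ball 0 1" and \<sigma>hol: "\<sigma> holomorphic_on ball 0 1"
    unfolding \<sigma>_def by (rule Moebius_function_holomorphic; use phi1[of 0] in simp)+
  have \<psi>im: "Moebius_function 0 (\<phi> 0) ` ball 0 1 \<subseteq> ball 0 1" and \<sigma>im: "\<sigma> ` ball 0 1 \<subseteq> ball 0 1"
    unfolding \<sigma>_def using Moebius_function_norm_lt_1[of "- \<phi> 0"] Moebius_function_norm_lt_1[of "\<phi> 0"] phi1[of 0] by auto
  have \<sigma>0: "\<sigma> 0 = \<phi> 0" by (simp add: \<sigma>_def Moebius_function_of_zero)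
  obtain s1 where s1: "s1 < 1" "\<And>w. cmod w \<le> \<rho> \<Longrightarrow> cmod (Moebius_function 0 (\<phi> 0) w) \<le> s1"
    using holomorphic_self_map_bound[OF \<psi>hol \<psi>im \<rho>(1,2)] by blast
  have "s1 \<ge> 0" using s1(2)[of 0] \<rho> norm_ge_zero order_trans by (metis norm_zero)
  \<comment> \<open>R^2 is the midpoint of s1 and 1, hence at least s1, below 1, and positive even
    for s1 = 0.\<close>
  define R where "R = sqrt ((1 + s1) / 2)"
  have R: "0 < R" "R < 1" "\<And>w. cmod w \<le> \<rho> \<Longrightarrow> cmod (Moebius_function 0 (\<phi> 0) w) \<le> R\<^sup>2"
  proof -
    show "0 < R" "R < 1" using s1(1) \<open>s1 \<ge> 0\<close> by (auto simp: R_def)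
    fix w :: complex assume "cmod w \<le> \<rho>"
    from s1(2)[OF this] s1(1) \<open>s1 \<ge> 0\<close> show "cmod (Moebius_function 0 (\<phi> 0) w) \<le> R\<^sup>2" by (simp add: R_def)
  qed
  \<comment> \<open>\<sigma> carries the closed disc of radius R into that of radius s < 1, where
    the pointwise bound with constant K2 is taken.\<close>
  obtain s where s: "s < 1" "\<And>v. cmod v \<le> R \<Longrightarrow> cmod (\<sigma> v) \<le> s"
    using holomorphic_self_map_bound[OF \<sigma>hol \<sigma>im less_imp_le[OF R(1)] R(2)] by blast
  define K1 :: real where "K1 = fact (2*n-1) * (n+1) ^ (2*n)"
  define K2 :: real where "K2 = (fact n)\<^sup>2 * (4 / (1 - s)) / ((1 - s) / 2) ^ (2 * n)"
  define D where "D = \<bar>C\<bar> * (8 * 4 ^ m)"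
  have D0: "D \<ge> 0" by (simp add: D_def)
  \<comment> \<open>2 K2 stems from the inner zero counts, a third K2 from |G 0|^2, which is
    subtracted in \<open>nn_integral_jensen\<close>, and D K1 from the weighted energy.\<close>
  have main: "circle_mean2 (D_op \<phi> n f) r \<le> (3 * K2 + D * K1) * H2_norm2 f" if f: "f \<in> H2" and r: "0 < r" "r < 1" for f r
  proof -
    define B where "B = H2_norm2 f"
    have B0: "B \<ge> 0" unfolding B_def by (rule H2_norm2_nonneg[OF f])
    text \<open>Truncation outside the disc makes the derivative Borel measurable on the whole plane.\<close>
    define g where "g = (\<lambda>z. if z \<in> ball 0 1 then (deriv ^^ n) f z else 0)"
    have dhol: "(deriv ^^ n) f holomorphic_on ball 0 1"
      using f unfolding H2_def by (intro holomorphic_higher_deriv) auto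
    have ghol: "g holomorphic_on ball 0 1"
      by (rule holomorphic_transform[OF dhol]) (simp add: g_def)
    have gm [measurable]: "g \<in> borel_measurable borel"
    proof -
      have "(\<lambda>z. indicator (ball 0 1) z *\<^sub>R (deriv ^^ n) f z) \<in> borel_measurable borel"
        by (rule borel_measurable_continuous_on_indicator[OF _ holomorphic_on_imp_continuous_on[OF dhol]]) simp
      moreover have "(\<lambda>z. indicator (ball 0 1) z *\<^sub>R (deriv ^^ n) f z) = g"
        by (auto simp: g_def indicator_def fun_eq_iff)
      ultimately show ?thesis by simp
    qed
    have gK: "(cmod (g w))\<^sup>2 \<le> K2 * B" if "cmod w \<le> s" for w
      using H2_deriv_growth[OF f that s(1), of n] that s(1) by (simp add: g_def K2_def B_def)
    define G where "G = (\<lambda>z. g (\<phi> z))"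
    define H where "H = (\<lambda>v. g (\<sigma> v))"
    have Ghol: "G holomorphic_on ball 0 1" and Hhol: "H holomorphic_on ball 0 1"
      using holomorphic_on_compose_gen[OF phi(1) ghol phi(2)] holomorphic_on_compose_gen[OF \<sigma>hol ghol \<sigma>im]
      by (simp_all add: o_def G_def H_def)
    let ?h = "\<lambda>q u. indicator {0<..} u * (ennreal (u ^ m) * ennreal (jensen g (exp (- u)) q))"
    note [measurable] = measurable_jensen_radius[OF gm] measurable_jensen[OF Hhol R(1,2)]
    \<comment> \<open>The excluded values of \<alpha> are those that put a zero at the origin: g
      (\<phi> 0) for both G and H, and g 0 for g itself.\<close>
    have "AE q in polar. ennreal (jensen G r q) \<le> ennreal D * (\<integral>\<^sup>+u. ?h q u \<partial>lborel) + ennreal 2 * ennreal (jensen H R q)"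
      using AE_polar_neq[of "g (\<phi> 0)"] AE_polar_neq[of "g 0"]
    proof eventually_elim
      case (elim q)
      have "(\<integral>\<^sup>+u. ?h q u \<partial>lborel) = (\<integral>\<^sup>+u. indicator {0<..} u * (ennreal (u ^ m) * ennreal (zero_count (\<lambda>w. g w - polar_pt q) (exp (- u)))) \<partial>lborel)"
      proof (intro nn_integral_cong)
        fix u :: real
        show "?h q u = indicator {0<..} u * (ennreal (u ^ m) * ennreal (zero_count (\<lambda>w. g w - polar_pt q) (exp (- u))))"
          using jensen_eq_zero_count[OF ghol, of "exp (-u)" q] elim by (cases "u > 0") auto
      qed
      moreover have "jensen G r q = zero_count (\<lambda>z. g (\<phi> z) - polar_pt q) r"
        using jensen_eq_zero_count[OF Ghol r, of q] elim by (simp add: G_def)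
      moreover have "jensen H R q = zero_count (\<lambda>v. g (\<sigma> v) - polar_pt q) R"
        using jensen_eq_zero_count[OF Hhol R(1,2), of q] elim by (simp add: H_def \<sigma>0)
      ultimately show ?case
        using zero_count_compose_le[OF phi ghol elim(1)[symmetric] elim(2)[symmetric] r \<rho>(1,2) abs_ge_zero N' R]
        by (simp add: D_def \<sigma>_def ennreal_mult')
    qed
    hence "(\<integral>\<^sup>+q. ennreal (jensen G r q) \<partial>polar) \<le> (\<integral>\<^sup>+q. ennreal D * (\<integral>\<^sup>+u. ?h q u \<partial>lborel) + ennreal 2 * ennreal (jensen H R q) \<partial>polar)"
      by (rule nn_integral_mono_AE)
    also have "\<dots> = ennreal D * (\<integral>\<^sup>+q. (\<integral>\<^sup>+u. ?h q u \<partial>lborel) \<partial>polar) + ennreal 2 * (\<integral>\<^sup>+q. ennreal (jensen H R q) \<partial>polar)"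
      by (subst nn_integral_add) (simp_all add: nn_integral_cmult)
    \<comment> \<open>With \<alpha> innermost, \<open>nn_integral_jensen\<close> for g applies at
      each radius e^(-u).\<close>
    also have "(\<integral>\<^sup>+q. (\<integral>\<^sup>+u. ?h q u \<partial>lborel) \<partial>polar) = (\<integral>\<^sup>+u. (\<integral>\<^sup>+q. ?h q u \<partial>polar) \<partial>lborel)"
    proof -
      interpret P: pair_sigma_finite polar "lborel :: real measure" ..
      show ?thesis by (rule P.Fubini'[symmetric]) measurable
    qed
    also have "\<dots> = (\<integral>\<^sup>+u. indicator {0<..} u * ennreal (u ^ (2*n-1)) *
        ennreal (circle_mean2 ((deriv ^^ n) f) (exp (-u)) - (cmod ((deriv ^^ n) f 0))\<^sup>2) \<partial>lborel)"
    proof (intro nn_integral_cong)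
      fix u :: real
      show "(\<integral>\<^sup>+q. ?h q u \<partial>polar) = indicator {0<..} u * ennreal (u ^ (2*n-1)) *
        ennreal (circle_mean2 ((deriv ^^ n) f) (exp (-u)) - (cmod ((deriv ^^ n) f 0))\<^sup>2)"
      proof (cases "u > 0")
        case True
        have [measurable]: "jensen g (exp (-u)) \<in> borel_measurable polar"
          by (rule measurable_jensen[OF ghol]) (use True in auto)
        have "(\<integral>\<^sup>+q. ?h q u \<partial>polar) = ennreal (u ^ m) * (\<integral>\<^sup>+q. ennreal (jensen g (exp (-u)) q) \<partial>polar)"
          using True by (simp add: nn_integral_cmult)
        also have "\<dots> = ennreal (u ^ m) * ennreal (circle_mean2 g (exp (-u)) - (cmod (g 0))\<^sup>2)"
          using nn_integral_jensen[OF ghol, of "exp (-u)"] True by simp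
        also have "circle_mean2 g (exp (-u)) = circle_mean2 ((deriv ^^ n) f) (exp (-u))"
          using True by (simp add: circle_mean2_def g_def norm_mult)
        finally show ?thesis using True by (simp add: m_def g_def)
      qed simp
    qed
    also have "\<dots> \<le> ennreal (K1 * B)"
      unfolding K1_def B_def by (rule order_trans[OF H2_deriv_energy[OF f n]]) (simp add: add.commute)
    also have "(\<integral>\<^sup>+q. ennreal (jensen H R q) \<partial>polar) = ennreal (circle_mean2 H R - (cmod (H 0))\<^sup>2)"
      by (rule nn_integral_jensen[OF Hhol R(1,2)])
    also have "\<dots> \<le> ennreal (K2 * B)"
    proof (rule ennreal_leI)
      have "circle_mean2 H R \<le> K2 * B"
      proof (rule circle_mean2_le)
        show "continuous_on (sphere 0 R) H"
          by (intro holomorphic_on_imp_continuous_on holomorphic_on_subset[OF Hhol]) (use R in auto)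
        show "(cmod (H z))\<^sup>2 \<le> K2 * B" if "cmod z = R" for z
          unfolding H_def by (rule gK, rule s(2)) (use that in simp)
      qed (use R in simp)
      thus "circle_mean2 H R - (cmod (H 0))\<^sup>2 \<le> K2 * B" using zero_le_power2[of "cmod (H 0)"] by linarith
    qed
    finally have "(\<integral>\<^sup>+q. ennreal (jensen G r q) \<partial>polar) \<le> ennreal D * ennreal (K1 * B) + ennreal 2 * ennreal (K2 * B)"
      by (simp add: mult_left_mono add_mono)
    moreover have KB: "0 \<le> K1 * B" "0 \<le> K2 * B" using B0 s(1) by (simp_all add: K1_def K2_def)
    ultimately have "ennreal (circle_mean2 G r - (cmod (G 0))\<^sup>2) \<le> ennreal (D * (K1 * B) + 2 * (K2 * B))"
      unfolding nn_integral_jensen[OF Ghol r] using D0 by (simp add: ennreal_mult)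
    hence "circle_mean2 G r - (cmod (G 0))\<^sup>2 \<le> D * (K1 * B) + 2 * (K2 * B)"
      using D0 KB by (subst (asm) ennreal_le_iff) auto
    \<comment> \<open>G 0 is the value of g at \<sigma> 0, and 0 lies in the disc of radius
      R.\<close>
    moreover have "(cmod (G 0))\<^sup>2 \<le> K2 * B"
      unfolding G_def \<sigma>0[symmetric] by (rule gK, rule s(2)) (use R in simp)
    moreover have "circle_mean2 (D_op \<phi> n f) r = circle_mean2 G r"
      using r phi1 by (simp add: circle_mean2_def G_def g_def D_op_def norm_mult)
    ultimately show ?thesis by (simp add: B_def algebra_simps)
  qed
  show ?thesis unfolding D_bounded_H2_def
  proof (intro exI ballI conjI)
    fix f assume f: "f \<in> H2"
    have dhol: "(deriv ^^ n) f holomorphic_on ball 0 1"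
      using f unfolding H2_def by (intro holomorphic_higher_deriv) auto
    have "D_op \<phi> n f holomorphic_on ball 0 1"
      unfolding D_op_def by (rule holomorphic_on_compose_gen[OF phi(1) dhol phi(2)])
    thus "D_op \<phi> n f \<in> H2" using main[OF f] unfolding H2_def
      by (auto intro!: bdd_aboveI2[where M = "(3 * K2 + D * K1) * H2_norm2 f"])
    show "H2_norm2 (D_op \<phi> n f) \<le> (3 * K2 + D * K1) * H2_norm2 f"
      unfolding H2_norm2_def[of "D_op \<phi> n f"] by (rule cSUP_least) (use main[OF f] in auto)
  qed
qed

theorem theorem2p1:
  fixes \<phi> :: "complex \<Rightarrow> complex" and n :: nat
  assumes "\<phi> holomorphic_on ball 0 1" and "\<phi> ` ball 0 1 \<subseteq> ball 0 1" and "n \<ge> 1"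
  shows "D_bounded_H2 \<phi> n \<longleftrightarrow>
    (\<exists>C r. r < 1 \<and> (\<forall>w. r < cmod w \<and> cmod w < 1 \<longrightarrow>
        nevanlinna \<phi> w \<le> ennreal (C * (ln (1 / cmod w)) ^ (2 * n + 1))))"
  using bounded_imp_nevanlinna[OF assms(1,2)] nevanlinna_imp_bounded[OF assms] by blast

end
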